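(* The group $\Gamma=\mathrm{Gal}(\overline{\mathbb{Q}}/\mathbb{Q})$ acts faithfully on the set of isomorphism classes of extra-clean normalized dessins, and it also acts faithfully on the set of isomorphism classes of normalized (clean) dessins.
   Context: Fix an embedding $\overline{\mathbb{Q}}\subset\mathbb{C}$. A (clean) Belyi polynomial is a polynomial $f\in\overline{\mathbb{Q}}[z]$ of degree at least $3$ all of whose critical values lie in $\{0,1\}$ and which has local degree exactly $2$ at every point of $f^{-1}(1)$. A dessin is a finite planar tree with at least three edges whose vertices are colored black and white so that every edge joins a black to a white vertex, and such that every white vertex is the endpoint of exactly two edges ("clean"). An isomorphism of dessins is an isomorphism of trees induced by an orientation-preserving homeomorphism of the plane (or sphere) and preserving colors. The dessin $\mathbf{D}_f$ of a Belyi polynomial $f$ is the tree $f^{-1}([0,1])$, with black vertices $f^{-1}(0)$, white vertices $f^{-1}(1)$, and edges the closures of the components of $f^{-1}((0,1))$. A normalized dessin is a dessin $\mathbf{D}$ together with an ordered pair $(z,w)$ of distinct vertices; an isomorphism of normalized dessins is an isomorphism of dessins carrying one ordered pair to the other. A normalized dessin is extra-clean if $z$ and $w$ are both ends (vertices incident to exactly one edge) of $\mathbf{D}$. A normalized Belyi polynomial is a pair $(f,(z,w))$ with $f$ a Belyi polynomial and $z\ne w$ in $f^{-1}(\{0,1\})$; $(f_1,(z_1,w_1))$ and $(f_2,(z_2,w_2))$ are isomorphic if there is an affine map $A$ of $\mathbb{C}$ with $f_1=f_2\circ A$, $A(z_1)=z_2$, $A(w_1)=w_2$. By the Grothendieck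 correspondence (known, may be assumed), $(f,(z,w))\mapsto(\mathbf{D}_f,(z,w))$ induces a bijection from isomorphism classes of normalized Belyi polynomials to isomorphism classes of normalized dessins. For $\sigma\in\Gamma$ let $f^\sigma$ be obtained by applying $\sigma$ to the coefficients of $f$. The action of $\Gamma$ on normalized dessins is the one transported from $\sigma\cdot[(f,(z,w))]=[(f^\sigma,(\sigma(z),\sigma(w)))]$; it preserves the extra-clean ones. An action on a set is faithful if every nonidentity $\sigma$ moves some element. *)

theory Defs
  imports
    "HOL-Algebra.Group_Action"
    "HOL-Complex_Analysis.Complex_Analysis"
    "HOL-Computational_Algebra.Polynomial"
begin

section \<open>The absolute Galois group of the rationals\<close>

definition Qbar :: "complex set" where
  "Qbar = {x. algebraic x}"

text \<open>Automorphisms are extensional functions, that is, \<open>undefined\<close> outside \<open>Qbar\<close>, and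
  the group law is composition, as in \<^const>\<open>BijGroup\<close>.\<close>

definition galois_group :: "(complex \<Rightarrow> complex) monoid" where
  "galois_group = (BijGroup Qbar)
     \<lparr>carrier := {\<sigma> \<in> Bij Qbar.
        (\<forall>x\<in>Qbar. \<forall>y\<in>Qbar. \<sigma> (x + y) = \<sigma> x + \<sigma> y) \<and>
        (\<forall>x\<in>Qbar. \<forall>y\<in>Qbar. \<sigma> (x * y) = \<sigma> x * \<sigma> y) \<and>
        (\<forall>q\<in>\<rat>. \<sigma> q = q)}\<rparr>"


section \<open>Normalized clean Belyi polynomials\<close>

definition belyi_polynomial :: "complex poly \<Rightarrow> bool" where
  "belyi_polynomial f \<longleftrightarrow>
     (\<forall>i. coeff f i \<in> Qbar) \<and> degree f \<ge> 3 \<and>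
     (\<forall>c. poly (pderiv f) c = 0 \<longrightarrow> poly f c \<in> {0, 1}) \<and>
     (\<forall>z. poly f z = 1 \<longrightarrow> Polynomial.order z (f - [:1:]) = 2)"

type_synonym pointed_poly = "complex poly \<times> complex \<times> complex"

definition normalized_belyi :: "pointed_poly set" where
  "normalized_belyi = {(f, z, w). belyi_polynomial f \<and> z \<noteq> w \<and>
     poly f z \<in> {0, 1} \<and> poly f w \<in> {0, 1}}"

definition belyi_iso :: "(pointed_poly \<times> pointed_poly) set" where
  "belyi_iso = {((f1, z1, w1), (f2, z2, w2)).
     (f1, z1, w1) \<in> normalized_belyi \<and> (f2, z2, w2) \<in> normalized_belyi \<and>
     (\<exists>a b. a \<noteq> 0 \<and> f1 = pcompose f2 [:b, a:] \<and> a * z1 + b = z2 \<and> a * w1 + b = w2)}"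

definition belyi_classes :: "pointed_poly set set" where
  "belyi_classes = normalized_belyi // belyi_iso"

definition belyi_action :: "(complex \<Rightarrow> complex) \<Rightarrow> pointed_poly set \<Rightarrow> pointed_poly set" where
  "belyi_action \<sigma> C = (\<Union>(f, z, w)\<in>C. belyi_iso `` {(map_poly \<sigma> f, \<sigma> z, \<sigma> w)})"


section \<open>Normalized dessins\<close>

text \<open>A bicoloured graph drawn in the complex plane; edges are given as closed subsets.\<close>

record plane_graph =
  black :: "complex set"
  white :: "complex set"
  edges :: "complex set set"

definition vertices :: "plane_graph \<Rightarrow> complex set" where
  "vertices D = black D \<union> white D"

definition support :: "plane_graph \<Rightarrow> complex set" where
  "support D = vertices D \<union> \<Union>(edges D)"

definition edges_at :: "plane_graph \<Rightarrow> complex \<Rightarrow> complex set set" where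
  "edges_at D v = {e \<in> edges D. v \<in> e}"

definition bicoloured_plane_graph :: "plane_graph \<Rightarrow> bool" where
  "bicoloured_plane_graph D \<longleftrightarrow>
     finite (black D) \<and> finite (white D) \<and> black D \<inter> white D = {} \<and> finite (edges D) \<and>
     (\<forall>e\<in>edges D. \<exists>g. arc g \<and> path_image g = e \<and>
        pathstart g \<in> black D \<and> pathfinish g \<in> white D \<and>
        e \<inter> vertices D = {pathstart g, pathfinish g}) \<and>
     (\<forall>e\<in>edges D. \<forall>e'\<in>edges D. e \<noteq> e' \<longrightarrow> e \<inter> e' \<subseteq> vertices D)"

text \<open>A circuit in a plane graph is the same thing as a simple closed curve in its support;
  this includes the circuits of length two, formed by two edges with common endpoints.\<close>

definition plane_tree :: "plane_graph \<Rightarrow> bool" where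
  "plane_tree D \<longleftrightarrow> bicoloured_plane_graph D \<and> connected (support D) \<and>
     \<not> (\<exists>g. simple_path g \<and> pathfinish g = pathstart g \<and> path_image g \<subseteq> support D)"

definition dessin :: "plane_graph \<Rightarrow> bool" where
  "dessin D \<longleftrightarrow> plane_tree D \<and> card (edges D) \<ge> 3 \<and>
     (\<forall>v\<in>white D. card (edges_at D v) = 2)"

type_synonym pointed_graph = "plane_graph \<times> complex \<times> complex"

definition normalized_dessins :: "pointed_graph set" where
  "normalized_dessins = {(D, z, w). dessin D \<and> z \<in> vertices D \<and> w \<in> vertices D \<and> z \<noteq> w}"

definition extra_clean_dessins :: "pointed_graph set" where
  "extra_clean_dessins = {(D, z, w) \<in> normalized_dessins.
     card (edges_at D z) = 1 \<and> card (edges_at D w) = 1}"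

text \<open>A homeomorphism of the plane acts on the fundamental group of a once punctured plane,
  which is infinite cyclic, with generator detected by the winding number. It preserves the
  orientation if and only if this action is by \<open>+1\<close> (rather than \<open>-1\<close>).\<close>

definition orientation_preserving_homeo :: "(complex \<Rightarrow> complex) \<Rightarrow> bool" where
  "orientation_preserving_homeo h \<longleftrightarrow> (\<exists>k. homeomorphism UNIV UNIV h k) \<and>
     (\<forall>\<gamma> p. path \<gamma> \<and> pathfinish \<gamma> = pathstart \<gamma> \<and> p \<notin> path_image \<gamma> \<longrightarrow>
        winding_number (h \<circ> \<gamma>) (h p) = winding_number \<gamma> p)"

definition dessin_iso :: "(pointed_graph \<times> pointed_graph) set" where
  "dessin_iso = {((D1, z1, w1), (D2, z2, w2)).
     (D1, z1, w1) \<in> normalized_dessins \<and> (D2, z2, w2) \<in> normalized_dessins \<and>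
     (\<exists>h. orientation_preserving_homeo h \<and>
        h ` black D1 = black D2 \<and> h ` white D1 = white D2 \<and>
        (\<lambda>e. h ` e) ` edges D1 = edges D2 \<and> h z1 = z2 \<and> h w1 = w2)}"

definition dessin_classes :: "pointed_graph set set" where
  "dessin_classes = normalized_dessins // dessin_iso"

definition extra_clean_classes :: "pointed_graph set set" where
  "extra_clean_classes = extra_clean_dessins // dessin_iso"

lemma equiv_dessin_iso: "equiv normalized_dessins dessin_iso"
proof (rule equivI)
  show "dessin_iso \<subseteq> normalized_dessins \<times> normalized_dessins"
    by (auto simp: dessin_iso_def)
  show "refl_on normalized_dessins dessin_iso"
  proof (rule refl_onI)
    fix x assume x: "x \<in> normalized_dessins"
    obtain D z w where eq: "x = (D, z, w)" by (cases x)
    have "orientation_preserving_homeo (\<lambda>x. x)"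
      by (auto simp: orientation_preserving_homeo_def o_def
          intro!: exI[of _ "\<lambda>x. x"] homeomorphismI)
    then show "(x, x) \<in> dessin_iso"
      using x unfolding eq dessin_iso_def by (auto intro!: exI[of _ "\<lambda>x. x"])
  qed
  show "sym dessin_iso"
  proof (rule symI)
    fix x y assume xy: "(x, y) \<in> dessin_iso"
    obtain D z w where x: "x = (D, z, w)" by (cases x)
    obtain D' z' w' where y: "y = (D', z', w')" by (cases y)
    from xy obtain h where
      n: "x \<in> normalized_dessins" "y \<in> normalized_dessins" and
      h: "orientation_preserving_homeo h" "h ` black D = black D'" "h ` white D = white D'"
        "(\<lambda>e. h ` e) ` edges D = edges D'" "h z = z'" "h w = w'"
      unfolding dessin_iso_def x y by auto
    from h(1) obtain k where k: "homeomorphism UNIV UNIV h k"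
      by (auto simp: orientation_preserving_homeo_def)
    then have kh: "k (h u) = u" and hk: "h (k u) = u" for u
      by (auto simp: homeomorphism_def)
    have "orientation_preserving_homeo k"
      unfolding orientation_preserving_homeo_def
    proof (intro conjI allI impI)
      show "\<exists>k'. homeomorphism UNIV UNIV k k'"
        using k homeomorphism_symD by blast
      fix \<gamma> :: "real \<Rightarrow> complex" and p assume g: "path \<gamma> \<and> pathfinish \<gamma> = pathstart \<gamma> \<and> p \<notin> path_image \<gamma>"
      have "continuous_on UNIV k" using k by (simp add: homeomorphism_def)
      then have "path (k \<circ> \<gamma>)"
        using g by (meson continuous_on_subset path_continuous_image subset_UNIV)
      moreover have "pathfinish (k \<circ> \<gamma>) = pathstart (k \<circ> \<gamma>)"
        using g by (simp add: pathfinish_def pathstart_def)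
      moreover have "k p \<notin> path_image (k \<circ> \<gamma>)"
        using g hk by (auto simp: path_image_def) (metis imageI atLeastAtMost_iff)
      ultimately have "winding_number (h \<circ> (k \<circ> \<gamma>)) (h (k p)) = winding_number (k \<circ> \<gamma>) (k p)"
        using h(1) by (auto simp: orientation_preserving_homeo_def)
      then show "winding_number (k \<circ> \<gamma>) (k p) = winding_number \<gamma> p"
        by (simp add: o_def hk)
    qed
    moreover have "k ` h ` A = A" for A
      by (simp add: image_image kh)
    ultimately show "(y, x) \<in> dessin_iso"
      using n h(2-) kh unfolding dessin_iso_def x y
      by (auto simp: image_image intro!: exI[of _ k] simp flip: h(2-4))
  qed
  show "trans dessin_iso"
  proof (rule transI)
    fix x y u assume xy: "(x, y) \<in> dessin_iso" and yu: "(y, u) \<in> dessin_iso"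
    obtain D z w where x: "x = (D, z, w)" by (cases x)
    obtain D' z' w' where y: "y = (D', z', w')" by (cases y)
    obtain D'' z'' w'' where u: "u = (D'', z'', w'')" by (cases u)
    from xy obtain h where
      n: "x \<in> normalized_dessins" and
      h: "orientation_preserving_homeo h" "h ` black D = black D'" "h ` white D = white D'"
        "(\<lambda>e. h ` e) ` edges D = edges D'" "h z = z'" "h w = w'"
      unfolding dessin_iso_def x y by auto
    from yu obtain k where
      n': "u \<in> normalized_dessins" and
      k: "orientation_preserving_homeo k" "k ` black D' = black D''" "k ` white D' = white D''"
        "(\<lambda>e. k ` e) ` edges D' = edges D''" "k z' = z''" "k w' = w''"
      unfolding dessin_iso_def y u by auto
    have "orientation_preserving_homeo (k \<circ> h)"
      unfolding orientation_preserving_homeo_def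
    proof (intro conjI allI impI)
      show "\<exists>l. homeomorphism UNIV UNIV (k \<circ> h) l"
        using h(1) k(1) homeomorphism_compose
        unfolding orientation_preserving_homeo_def by metis
      fix \<gamma> :: "real \<Rightarrow> complex" and p assume g: "path \<gamma> \<and> pathfinish \<gamma> = pathstart \<gamma> \<and> p \<notin> path_image \<gamma>"
      obtain l where l: "homeomorphism UNIV UNIV h l"
        using h(1) by (auto simp: orientation_preserving_homeo_def)
      have "continuous_on UNIV h" using l by (simp add: homeomorphism_def)
      then have "path (h \<circ> \<gamma>)"
        using g by (meson continuous_on_subset path_continuous_image subset_UNIV)
      moreover have "pathfinish (h \<circ> \<gamma>) = pathstart (h \<circ> \<gamma>)"
        using g by (simp add: pathfinish_def pathstart_def)
      moreover have "h p \<notin> path_image (h \<circ> \<gamma>)"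
        using g l by (auto simp: path_image_def homeomorphism_def)
          (metis imageI atLeastAtMost_iff)
      ultimately have "winding_number (k \<circ> (h \<circ> \<gamma>)) (k (h p)) = winding_number (h \<circ> \<gamma>) (h p)"
        using k(1) by (auto simp: orientation_preserving_homeo_def)
      also have "\<dots> = winding_number \<gamma> p"
        using h(1) g by (auto simp: orientation_preserving_homeo_def)
      finally show "winding_number (k \<circ> h \<circ> \<gamma>) ((k \<circ> h) p) = winding_number \<gamma> p"
        by (simp add: o_def)
    qed
    then show "(x, u) \<in> dessin_iso"
      using n n' h(2-) k(2-) unfolding dessin_iso_def x u
      by (auto simp: image_comp intro!: exI[of _ "k \<circ> h"] simp flip: k(2-4) h(2-4))
  qed
qed


section \<open>The Grothendieck correspondence and the Galois action on dessins\<close>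

definition dessin_of :: "complex poly \<Rightarrow> plane_graph" where
  "dessin_of f =
     \<lparr>black = {z. poly f z = 0},
      white = {z. poly f z = 1},
      edges = closure ` components (poly f -` (complex_of_real ` {0<..<1}))\<rparr>"

definition class_dessin_of :: "pointed_poly set \<Rightarrow> pointed_graph set" where
  "class_dessin_of C = (\<Union>(f, z, w)\<in>C. dessin_iso `` {(dessin_of f, z, w)})"

text \<open>The transported action; it is meaningful because \<open>class_dessin_of\<close> is a bijection from
  \<open>belyi_classes\<close> to \<open>dessin_classes\<close>.\<close>

definition dessin_action :: "(complex \<Rightarrow> complex) \<Rightarrow> pointed_graph set \<Rightarrow> pointed_graph set" where
  "dessin_action \<sigma> c =
     class_dessin_of (belyi_action \<sigma> (inv_into belyi_classes class_dessin_of c))"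

end

theory Submission
  imports Defs "HOL-Computational_Algebra.Fundamental_Theorem_Algebra"
begin

text \<open>Suppose \<open>\<sigma>\<close> moves \<open>\<alpha>\<close>. Let \<open>p\<close> be the antiderivative of \<open>z\<^sup>3 (z - 1)\<^sup>2 (z - \<alpha>)\<close> and
  compose it with a rational polynomial \<open>Q\<close>, obtained by Belyi's algorithm, so that \<open>Q \<circ> p\<close> is a
  clean Belyi polynomial; counting critical points, it has at least two simple zeros \<open>z\<close>, \<open>w\<close>.
  If \<open>\<sigma>\<close> fixed the class of \<open>(Q \<circ> p, z, w)\<close>, then \<open>Q \<circ> p = Q \<circ> p\<^sup>\<sigma> \<circ> A\<close> with \<open>A\<close> affine. By
  Lenstra's cancellation lemma \<open>p\<close> and \<open>p\<^sup>\<sigma> \<circ> A\<close> then differ by an affine map on the left, so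
  \<open>A\<close> respects critical points with their multiplicities 3, 2, 1, which forces \<open>A = id\<close> and
  \<open>\<sigma>(\<alpha>) = \<alpha>\<close>. For extra-cleanness, the ends of a dessin are the simple zeros of its
  polynomial: at a zero of order \<open>n\<close>, the preimage of \<open>(0,1)\<close> consists locally of \<open>n\<close> rays, no
  two of which lie on a common edge.\<close>

text \<open>Rationality of \<open>Q\<close> is what starts the argument: \<sigma> fixes
  \<open>Q\<close>, so a fixed class yields an equation whose two sides carry the same outer
  polynomial, and this is the situation in which cancellation applies. What remains is to recover
  \<alpha> from p up to affine maps on both sides; placing two of the three critical points at 0 and
  1, which every \<sigma> fixes, makes this possible. The marked points are chosen as simple zeros
  so that one moved class serves both actions. The correspondence is available only as a bijection
  of classes. Hence the Galois side is done entirely with polynomials, and extra-cleanness has to be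
  recognised on them; that \<open>dessin_of f\<close> is a dessin is read off from the bijection,
  and only the local picture at a zero is proved topologically.\<close>

section \<open>Algebraic numbers\<close>

text \<open>More vectors than generators force a relation. It is a relation for the indexed family,
  not for its image, so a repeated value must yield one as well; hence the case split. It is applied
  to the powers of a number and to the powers of a polynomial modulo another.\<close>

lemma (in vector_space) linear_relation_in_span:
  assumes "finite T" "card T \<le> n" and f: "\<And>i. i \<le> n \<Longrightarrow> f i \<in> span T"
  obtains c i where "i \<le> n" "c i \<noteq> 0" "(\<Sum>i\<le>n. scale (c i) (f i)) = 0"
proof (cases "inj_on f {..n}")
  case True
  have "card (f ` {..n}) > card T"
    using True assms(2) by (simp add: card_image)
  moreover have "f ` {..n} \<subseteq> span T" using f by auto
  ultimately have "dependent (f ` {..n})"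
    using independent_span_bound[OF assms(1)] by (meson leD)
  then obtain u v where u: "v \<in> f ` {..n}" "u v \<noteq> 0" "(\<Sum>v\<in>f ` {..n}. scale (u v) v) = 0"
    by (auto simp: dependent_finite)
  then obtain i where "i \<le> n" "u (f i) \<noteq> 0" by auto
  moreover have "(\<Sum>i\<le>n. scale (u (f i)) (f i)) = 0"
    using u(3) by (simp add: sum.reindex[OF True])
  ultimately show ?thesis using that[of i "\<lambda>i. u (f i)"] by simp
next
  case False
  then obtain i j where ij: "i \<le> n" "j \<le> n" "i \<noteq> j" "f i = f j"
    by (auto simp: inj_on_def)
  let ?c = "\<lambda>k. if k = i then 1 else if k = j then - 1 else 0 :: 'a"
  have "(\<Sum>k\<le>n. scale (?c k) (f k)) = (\<Sum>k\<in>{i, j}. scale (?c k) (f k))"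
    by (rule sum.mono_neutral_right) (use ij in auto)
  also have "\<dots> = 0" using ij by simp
  finally show ?thesis using that[of i ?c] ij by simp
qed

interpretation rat_complex: vector_space "\<lambda>(q::rat) (x::complex). of_rat q * x"
  by unfold_locales (simp_all add: algebra_simps of_rat_add of_rat_mult)

lemma mult_mem_span:
  assumes "\<And>t. t \<in> T \<Longrightarrow> x * t \<in> rat_complex.span T'" "v \<in> rat_complex.span T"
  shows "x * v \<in> rat_complex.span T'"
  using assms(2)
proof (induction rule: rat_complex.span_induct_alt)
  case base
  show ?case by (simp add: rat_complex.span_zero)
next
  case (step c t v)
  have "x * (of_rat c * t + v) = of_rat c * (x * t) + x * v" by (simp add: algebra_simps)
  with step assms(1) show ?case
    by (simp add: rat_complex.span_add rat_complex.span_scale)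
qed

text \<open>The numbers \<open>x ^ i * u\<close> all stay in a space of finite dimension over the
  rationals, so \<open>card T + 1\<close> of them are dependent, and dividing the relation by
  \<open>u\<close> gives an equation for \<open>x\<close>. This replaces the determinant of the
  usual integrality argument.\<close>

lemma algebraic_if_stable_span:
  assumes "finite T" "u \<noteq> 0" "u \<in> rat_complex.span T"
    and x: "\<And>v. v \<in> rat_complex.span T \<Longrightarrow> x * v \<in> rat_complex.span T"
  shows "algebraic x"
proof -
  have "x ^ i * u \<in> rat_complex.span T" for i
    by (induction i) (use assms in \<open>auto simp: mult.assoc\<close>)
  then obtain c i where c: "i \<le> card T" "c i \<noteq> 0"
      "(\<Sum>i\<le>card T. of_rat (c i) * (x ^ i * u)) = 0"
    using rat_complex.linear_relation_in_span[of T "card T" "\<lambda>i. x ^ i * u"] assms(1)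
    by blast
  define p :: "complex poly" where "p = (\<Sum>i\<le>card T. monom (of_rat (c i)) i)"
  have co: "coeff p k = (if k \<le> card T then of_rat (c k) else 0)" for k
    by (simp add: p_def coeff_sum if_distrib cong: if_cong)
  then have "p \<noteq> 0" using c(1,2) by (metis coeff_0 of_rat_eq_0_iff)
  moreover have "poly p x * u = 0"
    using c(3) by (simp add: p_def poly_sum poly_monom sum_distrib_right mult.assoc)
  ultimately show ?thesis
    unfolding algebraic_altdef using co assms(2) by (intro exI[of _ p]) auto
qed

text \<open>Multiplying the generators by 1, z, ..., z^(n-1) gives a space that z preserves as well.
  The coefficients \<open>b i\<close> need only act on the span of \<open>T\<close>, so the same
  lemma adjoins a number algebraic over the rationals and a root of a polynomial with algebraic
  coefficients.\<close>

lemma stable_span_extend: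
  assumes T: "finite T" "1 \<in> T" and "finite A"
    and A: "\<And>a v. a \<in> A \<Longrightarrow> v \<in> rat_complex.span T \<Longrightarrow> a * v \<in> rat_complex.span T"
    and z: "z ^ n = (\<Sum>i<n. b i * z ^ i)"
    and b: "\<And>i v. i < n \<Longrightarrow> v \<in> rat_complex.span T \<Longrightarrow> b i * v \<in> rat_complex.span T"
  obtains T' where "finite T'" "1 \<in> T'"
    "\<And>a v. a \<in> insert z A \<Longrightarrow> v \<in> rat_complex.span T' \<Longrightarrow> a * v \<in> rat_complex.span T'"
proof -
  define T' where "T' = (\<lambda>(t, j). t * z ^ j) ` (T \<times> {..<n})"
  \<comment> \<open>For n = 0 the relation would read 1 = 0.\<close>
  have n: "n > 0" using z by (cases n) auto
  have gen: "t * z ^ j \<in> rat_complex.span T'" if "t \<in> rat_complex.span T" "j < n" for t j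
  proof -
    have "z ^ j * t \<in> rat_complex.span T'"
      by (rule mult_mem_span[OF _ that(1)])
        (use that(2) in \<open>auto simp: T'_def mult.commute[of "z ^ j"] intro!: rat_complex.span_base\<close>)
    then show ?thesis by (simp add: mult.commute[of "z ^ j"])
  qed
  show ?thesis
  proof (rule that[of T'])
    show "finite T'" using T by (simp add: T'_def)
    show "1 \<in> T'" unfolding T'_def using T(2) n by (intro image_eqI[of _ _ "(1, 0)"]) auto
    fix a v assume a: "a \<in> insert z A" and v: "v \<in> rat_complex.span T'"
    show "a * v \<in> rat_complex.span T'"
    proof (rule mult_mem_span[OF _ v])
      fix s assume "s \<in> T'"
      then obtain t j where s: "s = t * z ^ j" "t \<in> T" "j < n" by (auto simp: T'_def)
      have t: "t \<in> rat_complex.span T" using s(2) by (rule rat_complex.span_base)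
      consider "a \<in> A" | "a = z" "Suc j < n" | "a = z" "Suc j = n" using a s(3) by force
      then show "a * s \<in> rat_complex.span T'"
      proof cases
        case 1
        then show ?thesis using gen[OF A[OF 1 t] s(3)] by (simp add: s(1) mult.assoc)
      next
        case 2
        then show ?thesis using gen[OF t 2(2)] by (simp add: s(1) algebra_simps)
      next
        case 3
        \<comment> \<open>Only here does the exponent of z leave the allowed range, and the relation
          for \<open>z ^ n\<close> brings it back.\<close>
        have "a * s = z ^ n * t" using 3 s(1) by (auto simp: algebra_simps simp flip: 3(2))
        also have "\<dots> = (\<Sum>i<n. (b i * t) * z ^ i)"
          by (simp add: z sum_distrib_right sum_distrib_left algebra_simps)
        also have "\<dots> \<in> rat_complex.span T'"
          by (intro rat_complex.span_sum gen b t) auto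
        finally show ?thesis .
      qed
    qed
  qed
qed

lemma algebraic_power_eq:
  fixes x :: complex
  assumes "algebraic x"
  obtains n c where "x ^ n = (\<Sum>i<n. of_rat (c i) * x ^ i)"
proof -
  obtain p where p: "\<And>i. coeff p i \<in> \<rat>" "p \<noteq> 0" "poly p x = 0"
    using assms unfolding algebraic_altdef by blast
  have "\<exists>q. - coeff p i / lead_coeff p = of_rat q" for i
    using p(1) by (auto intro!: Rats_divide elim: Rats_cases)
      (metis Rats_cases Rats_divide Rats_minus_iff minus_divide_left)
  then obtain c where c: "\<And>i. - coeff p i / lead_coeff p = of_rat (c i)" by metis
  have "(\<Sum>i<degree p. coeff p i * x ^ i) + lead_coeff p * x ^ degree p = 0"
    using p(3) by (simp add: poly_altdef flip: lessThan_Suc_atMost)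
  then have "x ^ degree p = - (\<Sum>i<degree p. coeff p i * x ^ i) / lead_coeff p"
    using p(2) by (simp add: field_simps eq_neg_iff_add_eq_0)
  also have "\<dots> = (\<Sum>i<degree p. of_rat (c i) * x ^ i)"
    by (simp add: sum_divide_distrib flip: c sum_negf)
  finally show ?thesis by (rule that)
qed

lemma finite_algebraic_stable_span:
  fixes A :: "complex set"
  assumes "finite A" "\<And>a. a \<in> A \<Longrightarrow> algebraic a"
  obtains T where "finite T" "1 \<in> T"
    "\<And>a v. a \<in> A \<Longrightarrow> v \<in> rat_complex.span T \<Longrightarrow> a * v \<in> rat_complex.span T"
  using assms
proof (induction A arbitrary: thesis rule: finite_induct)
  case empty
  show ?case by (rule empty(1)[of "{1}"]) auto
next
  case (insert x F)
  obtain T where T: "finite T" "1 \<in> T"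
    "\<And>a v. a \<in> F \<Longrightarrow> v \<in> rat_complex.span T \<Longrightarrow> a * v \<in> rat_complex.span T"
    using insert.IH insert.prems(2) by blast
  obtain n c where "x ^ n = (\<Sum>i<n. of_rat (c i) * x ^ i)"
    using algebraic_power_eq insert.prems(2) by blast
  from stable_span_extend[OF T(1,2) \<open>finite F\<close> T(3) this rat_complex.span_scale]
  show ?case using insert.prems(1) by blast
qed

lemma algebraic_add_mult:
  fixes x y :: complex
  assumes "algebraic x" "algebraic y"
  shows algebraic_add: "algebraic (x + y)" and algebraic_mult: "algebraic (x * y)"
proof -
  obtain T where T: "finite T" "1 \<in> T"
    and st: "\<And>a v. a \<in> {x, y} \<Longrightarrow> v \<in> rat_complex.span T \<Longrightarrow> a * v \<in> rat_complex.span T"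
    using finite_algebraic_stable_span[of "{x, y}"] assms by blast
  have 1: "1 \<in> rat_complex.span T" using T(2) by (rule rat_complex.span_base)
  show "algebraic (x + y)"
    by (rule algebraic_if_stable_span[OF T(1) _ 1])
      (auto simp: ring_distribs intro!: rat_complex.span_add st)
  show "algebraic (x * y)"
    by (rule algebraic_if_stable_span[OF T(1) _ 1]) (auto simp: mult.assoc intro!: st)
qed

text \<open>Transitivity of algebraicity: the finitely many coefficients of the monic form preserve
  a common finite-dimensional space, and adjoining z enlarges it to one that z preserves.\<close>

lemma algebraic_root:
  fixes p :: "complex poly"
  assumes "p \<noteq> 0" "\<And>i. algebraic (coeff p i)" "poly p z = 0"
  shows "algebraic z"
proof -
  define n where "n = degree p"
  define b where "b i = - coeff p i / lead_coeff p" for i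
  have b: "algebraic (b i)" for i
    unfolding b_def divide_inverse
    by (intro algebraic_mult algebraic_minus algebraic_inverse assms)
  have "(\<Sum>i<n. coeff p i * z ^ i) + lead_coeff p * z ^ n = 0"
    using assms(3) by (simp add: n_def poly_altdef flip: lessThan_Suc_atMost)
  then have "z ^ n = - (\<Sum>i<n. coeff p i * z ^ i) / lead_coeff p"
    using assms(1) by (simp add: field_simps eq_neg_iff_add_eq_0)
  then have z: "z ^ n = (\<Sum>i<n. b i * z ^ i)"
    by (simp add: sum_divide_distrib b_def flip: sum_negf)
  obtain T where T: "finite T" "1 \<in> T"
    and st: "\<And>a v. a \<in> b ` {..<n} \<Longrightarrow> v \<in> rat_complex.span T \<Longrightarrow> a * v \<in> rat_complex.span T"
    using finite_algebraic_stable_span[of "b ` {..<n}"] b by blast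
  have st': "b i * v \<in> rat_complex.span T" if "i < n" "v \<in> rat_complex.span T" for i v
    using that st by auto
  obtain T' where T': "finite T'" "1 \<in> T'"
    and z': "\<And>a v. a \<in> insert z {} \<Longrightarrow> v \<in> rat_complex.span T' \<Longrightarrow> a * v \<in> rat_complex.span T'"
    using stable_span_extend[OF T finite.emptyI _ z st'] by blast
  show ?thesis
    by (rule algebraic_if_stable_span[OF T'(1) _ rat_complex.span_base[OF T'(2)]]) (use z' in auto)
qed

lemma Qbar_add [intro]: "x \<in> Qbar \<Longrightarrow> y \<in> Qbar \<Longrightarrow> x + y \<in> Qbar"
  and Qbar_mult [intro]: "x \<in> Qbar \<Longrightarrow> y \<in> Qbar \<Longrightarrow> x * y \<in> Qbar"
  and Qbar_uminus [intro]: "x \<in> Qbar \<Longrightarrow> - x \<in> Qbar"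
  and Qbar_inverse [intro]: "x \<in> Qbar \<Longrightarrow> inverse x \<in> Qbar"
  by (auto simp: Qbar_def algebraic_add algebraic_mult)

lemma Rats_subset_Qbar: "\<rat> \<subseteq> Qbar"
proof
  fix q :: complex assume q: "q \<in> \<rat>"
  have "\<forall>i. coeff [:- q, 1:] i \<in> \<rat>" using q by (auto simp: coeff_pCons split: nat.split)
  then have "algebraic q"
    unfolding algebraic_altdef by (intro exI[of _ "[:- q, 1:]"]) auto
  then show "q \<in> Qbar" by (simp add: Qbar_def)
qed

lemma Qbar_of_rat [simp, intro]: "of_rat q \<in> Qbar"
  using Rats_subset_Qbar by auto

lemma Qbar_0 [simp, intro]: "0 \<in> Qbar" and Qbar_1 [simp, intro]: "1 \<in> Qbar"
  and Qbar_numeral [simp, intro]: "numeral k \<in> Qbar"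
  using Rats_subset_Qbar by auto

lemma Qbar_diff [intro]: "x \<in> Qbar \<Longrightarrow> y \<in> Qbar \<Longrightarrow> x - y \<in> Qbar"
  using Qbar_add[of x "- y"] by auto

lemma Qbar_divide [intro]: "x \<in> Qbar \<Longrightarrow> y \<in> Qbar \<Longrightarrow> x / y \<in> Qbar"
  unfolding divide_inverse by auto


section \<open>Belyi's algorithm over the rationals\<close>

text \<open>Belyi's algorithm runs in the type \<open>rat poly\<close>, so that rationality of its
  result is carried by the type; this embedding allows evaluation at complex points.\<close>

definition of_rat_poly :: "rat poly \<Rightarrow> complex poly" where
  "of_rat_poly = map_poly of_rat"

lemma coeff_of_rat_poly [simp]: "coeff (of_rat_poly p) i = of_rat (coeff p i)"
  by (simp add: of_rat_poly_def coeff_map_poly)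

lemma of_rat_poly_0 [simp]: "of_rat_poly 0 = 0"
  and of_rat_poly_pCons [simp]: "of_rat_poly (pCons a p) = pCons (of_rat a) (of_rat_poly p)"
  and of_rat_poly_add [simp]: "of_rat_poly (p + q) = of_rat_poly p + of_rat_poly q"
  and of_rat_poly_diff [simp]: "of_rat_poly (p - q) = of_rat_poly p - of_rat_poly q"
  and of_rat_poly_smult [simp]: "of_rat_poly (smult c p) = smult (of_rat c) (of_rat_poly p)"
  and of_rat_poly_pderiv: "of_rat_poly (pderiv p) = pderiv (of_rat_poly p)"
  by (auto intro!: poly_eqI simp: of_rat_add of_rat_diff of_rat_mult coeff_pderiv coeff_pCons
      split: nat.split)

lemma of_rat_poly_mult [simp]: "of_rat_poly (p * q) = of_rat_poly p * of_rat_poly q"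
  by (auto intro!: poly_eqI simp: coeff_mult of_rat_sum of_rat_mult)

lemma of_rat_poly_pcompose: "of_rat_poly (pcompose p q) = pcompose (of_rat_poly p) (of_rat_poly q)"
  by (induction p) (auto simp: pcompose_pCons)

lemma poly_of_rat_poly [simp]: "poly (of_rat_poly p) (of_rat x) = of_rat (poly p x)"
  by (induction p) (auto simp: of_rat_add of_rat_mult)

lemma of_rat_poly_eq_0_iff [simp]: "of_rat_poly p = 0 \<longleftrightarrow> p = 0"
  by (auto simp: poly_eq_iff)

lemma degree_of_rat_poly [simp]: "degree (of_rat_poly p) = degree p"
  by (simp add: of_rat_poly_def degree_map_poly)

interpretation rat_poly: vector_space "smult :: rat \<Rightarrow> rat poly \<Rightarrow> rat poly"
  by unfold_locales (simp_all add: smult_add_left smult_add_right)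

lemma pcompose_monom: "pcompose (monom c n) p = smult c (p ^ n)"
  by (induction n) (auto simp: monom_0 monom_Suc pcompose_pCons pcompose_const)

lemma poly_in_span_monom:
  assumes "degree p < m"
  shows "p \<in> rat_poly.span (monom 1 ` {..<m})"
proof -
  have "p = (\<Sum>i\<le>degree p. smult (coeff p i) (monom 1 i))"
    by (simp add: smult_monom poly_as_sum_of_monoms)
  also have "\<dots> \<in> rat_poly.span (monom 1 ` {..<m})"
    using assms by (intro rat_poly.span_sum rat_poly.span_scale rat_poly.span_base) auto
  finally show ?thesis .
qed

text \<open>The powers of \<open>P\<close> modulo \<open>M\<close> are linearly dependent, so \<open>R\<close> exists without any
  appeal to resultants.\<close>

lemma rational_annihilator_of_image:
  fixes P M :: "rat poly"
  assumes "degree M > 0"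
  obtains R where "R \<noteq> 0" "degree R \<le> degree M"
    "\<And>\<xi>. poly (of_rat_poly M) \<xi> = 0 \<Longrightarrow> poly (of_rat_poly R) (poly (of_rat_poly P) \<xi>) = 0"
proof -
  define m where "m = degree M"
  have "degree (P ^ i mod M) < m" for i
    using assms degree_mod_less'[of M "P ^ i"] unfolding m_def
    by (cases "P ^ i mod M = 0"; cases "M = 0") auto
  then have "P ^ i mod M \<in> rat_poly.span (monom 1 ` {..<m})" for i
    by (rule poly_in_span_monom)
  moreover have "card (monom (1::rat) ` {..<m}) \<le> m"
    using card_image_le[of "{..<m}"] by auto
  ultimately obtain c i where c: "i \<le> m" "c i \<noteq> 0"
      "(\<Sum>i\<le>m. smult (c i) (P ^ i mod M)) = 0"
    using rat_poly.linear_relation_in_span[of "monom 1 ` {..<m}" m "\<lambda>i. P ^ i mod M"] by blast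
  define R where "R = (\<Sum>i\<le>m. monom (c i) i)"
  have co: "coeff R k = (if k \<le> m then c k else 0)" for k
    by (simp add: R_def coeff_sum if_distrib cong: if_cong)
  show ?thesis
  proof (rule that[of R])
    show "R \<noteq> 0" using c(1,2) co by (metis coeff_0)
    show "degree R \<le> degree M" by (rule degree_le) (simp add: co m_def)
    fix \<xi> assume \<xi>: "poly (of_rat_poly M) \<xi> = 0"
    have "pcompose R P = (\<Sum>i\<le>m. smult (c i) (P ^ i))"
      by (simp add: R_def pcompose_sum pcompose_monom)
    \<comment> \<open>The combination of the remainders vanishes, so it may be subtracted; each
      difference that is left is a multiple of \<open>M\<close>.\<close>
    then have "pcompose R P = (\<Sum>i\<le>m. smult (c i) (P ^ i - P ^ i mod M))"
      using c(3) by (simp add: smult_diff_right sum_subtractf)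
    then have "M dvd pcompose R P"
      by (simp only:) (intro dvd_sum dvd_smult dvd_minus_mod)
    then obtain Q where "pcompose R P = M * Q" by (elim dvdE)
    then have "of_rat_poly (pcompose R P) = of_rat_poly M * of_rat_poly Q" by simp
    then show "poly (of_rat_poly R) (poly (of_rat_poly P) \<xi>) = 0"
      by (metis \<xi> mult_zero_left of_rat_poly_pcompose poly_mult poly_pcompose)
  qed
qed

text \<open>First half of the algorithm, by induction on the degree. \<open>P\<close> itself sends
  its roots to 0 and its critical points to roots of some \<open>R\<close> of smaller degree.
  Composing the map h for \<open>R\<close> with \<open>P\<close> then works: h(0) is rational, h is
  rational at the roots of \<open>R\<close>, and the other critical values of the composite are
  critical values of h.\<close>

lemma rational_critical_values:
  fixes P :: "rat poly"
  assumes "P \<noteq> 0"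
  obtains h :: "rat poly" where "degree h > 0"
    "\<And>\<xi>. poly (of_rat_poly P) \<xi> = 0 \<Longrightarrow> poly (of_rat_poly h) \<xi> \<in> \<rat>"
    "\<And>\<xi>. poly (of_rat_poly (pderiv h)) \<xi> = 0 \<Longrightarrow> poly (of_rat_poly h) \<xi> \<in> \<rat>"
  using assms
proof (induction "degree P" arbitrary: P thesis rule: less_induct)
  case less
  show ?case
  proof (cases "degree P \<le> 1")
    case True
    then obtain a b where P: "P = [:a, b:]" by (metis degree_eq_zeroE degree1_coeffs le_less less_one pCons_0_0)
    show ?thesis
    \<comment> \<open>With degree at most 1 the roots are already rational, and the identity has no
      critical points.\<close>
    proof (rule less.prems(1)[of "[:0, 1:]"])
      fix \<xi> assume \<xi>: "poly (of_rat_poly P) \<xi> = 0"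
      then have eq: "of_rat a + \<xi> * of_rat b = 0" by (simp add: P)
      have "b \<noteq> 0" using eq less.prems(2) P by auto
      then have "\<xi> = of_rat (- a / b)"
        using eq by (simp add: of_rat_divide of_rat_minus field_simps eq_neg_iff_add_eq_0)
      then show "poly (of_rat_poly [:0, 1:]) \<xi> \<in> \<rat>" by simp
    qed (auto simp: pderiv_pCons)
  next
    case False
    then have deg: "degree (pderiv P) = degree P - 1" "degree (pderiv P) > 0"
      by (auto simp: degree_pderiv)
    obtain R where R: "R \<noteq> 0" "degree R \<le> degree (pderiv P)"
      "\<And>\<xi>. poly (of_rat_poly (pderiv P)) \<xi> = 0 \<Longrightarrow>
        poly (of_rat_poly R) (poly (of_rat_poly P) \<xi>) = 0"
      using rational_annihilator_of_image[OF deg(2)] by blast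
    have "degree R < degree P" using R(2) deg False by linarith
    from less.hyps[OF this _ R(1)] obtain h where h: "degree h > 0"
      "\<And>\<xi>. poly (of_rat_poly R) \<xi> = 0 \<Longrightarrow> poly (of_rat_poly h) \<xi> \<in> \<rat>"
      "\<And>\<xi>. poly (of_rat_poly (pderiv h)) \<xi> = 0 \<Longrightarrow> poly (of_rat_poly h) \<xi> \<in> \<rat>"
      by blast
    show ?thesis
    proof (rule less.prems(1)[of "pcompose h P"])
      show "degree (pcompose h P) > 0" using h(1) False by (simp add: degree_pcompose)
      fix \<xi>
      show "poly (of_rat_poly (pcompose h P)) \<xi> \<in> \<rat>" if "poly (of_rat_poly P) \<xi> = 0"
        using that poly_of_rat_poly[of h 0] by (simp add: of_rat_poly_pcompose poly_pcompose)
      show "poly (of_rat_poly (pcompose h P)) \<xi> \<in> \<rat>"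
        if "poly (of_rat_poly (pderiv (pcompose h P))) \<xi> = 0"
        using that R(3) h(2,3) by (auto simp: of_rat_poly_pcompose poly_pcompose pderiv_pcompose)
    qed
  qed
qed

text \<open>Apart from a and c, the polynomial (x-a)^m (c-x)^k has the single critical point (k a +
  m c)/(m + k). Choosing m/k = (b-a)/(c-b) puts it at b, and scaling makes the value there
  1.\<close>

lemma belyi_three_points:
  fixes a b c :: rat
  assumes "a < b" "b < c"
  obtains \<beta> :: "rat poly" where "degree \<beta> > 0" "poly \<beta> a = 0" "poly \<beta> b = 1" "poly \<beta> c = 0"
    "\<And>\<xi>. poly (of_rat_poly (pderiv \<beta>)) \<xi> = 0 \<Longrightarrow> poly (of_rat_poly \<beta>) \<xi> \<in> {0, 1}"
proof -
  obtain m k :: int where mk: "quotient_of ((b - a) / (c - b)) = (m, k)"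
    by (cases "quotient_of ((b - a) / (c - b))")
  have k: "k > 0" using quotient_of_denom_pos[OF mk] .
  have q: "(b - a) / (c - b) = of_int m / of_int k" using quotient_of_div[OF mk] .
  have "(b - a) / (c - b) > 0" using assms by simp
  then have m: "m > 0" using k unfolding q by (simp add: zero_less_divide_iff)
  obtain m' k' where mk': "m = int (Suc m')" "k = int (Suc k')"
    using m k by (metis gr0_implies_Suc pos_int_cases)
  define B where "B = [:- a, 1:] ^ Suc m' * [:c, - 1:] ^ Suc k'"
  have B: "poly B b \<noteq> 0" using assms by (simp add: B_def)
  define \<beta> where "\<beta> = smult (inverse (poly B b)) B"
  have vals: "poly \<beta> a = 0" "poly \<beta> b = 1" "poly \<beta> c = 0"
    using B by (simp add: \<beta>_def B_def, simp add: \<beta>_def, simp add: \<beta>_def B_def)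
  have pd: "pderiv [:- a, 1:] = 1" "pderiv [:c, - 1:] = - 1"
    by (simp_all add: pderiv_pCons one_pCons)
  \<comment> \<open>The logarithmic derivative of \<open>B\<close> with denominators cleared;
    besides the roots of \<open>B\<close> only a linear factor is left.\<close>
  have eq: "pderiv B * ([:- a, 1:] * [:c, - 1:]) =
      B * (smult (of_nat (Suc m')) [:c, - 1:] - smult (of_nat (Suc k')) [:- a, 1:])"
    unfolding B_def pderiv_mult pderiv_power_Suc pd
    by (simp add: algebra_simps del: of_nat_Suc mult_pCons_left mult_pCons_right smult_pCons)
  show ?thesis
  proof (rule that[OF _ vals])
    show "degree \<beta> > 0"
    proof (rule ccontr)
      assume "\<not> degree \<beta> > 0"
      then obtain x where "\<beta> = [:x:]" by (auto elim: degree_eq_zeroE)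
      with vals show False by simp
    qed
    fix \<xi> assume "poly (of_rat_poly (pderiv \<beta>)) \<xi> = 0"
    then have "poly (of_rat_poly (pderiv B)) \<xi> = 0" using B by (simp add: \<beta>_def pderiv_smult)
    then have "poly (of_rat_poly (pderiv B * ([:- a, 1:] * [:c, - 1:]))) \<xi> = 0" 
      unfolding of_rat_poly_mult by simp
    moreover have lin: "poly (of_rat_poly (smult (of_nat (Suc m')) [:c, - 1:] -
          smult (of_nat (Suc k')) [:- a, 1:])) \<xi> =
        of_nat (Suc m') * (of_rat c - \<xi>) - of_nat (Suc k') * (\<xi> - of_rat a)"
      by (simp add: of_rat_add of_rat_mult of_rat_diff of_rat_minus algebra_simps)
    ultimately have "poly (of_rat_poly B) \<xi> = 0 \<or>
      of_nat (Suc m') * (of_rat c - \<xi>) = of_nat (Suc k') * (\<xi> - of_rat a)"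
      unfolding eq of_rat_poly_mult poly_mult lin mult_eq_0_iff by auto
    then show "poly (of_rat_poly \<beta>) \<xi> \<in> {0, 1}"
    proof
      assume "poly (of_rat_poly B) \<xi> = 0"
      then show ?thesis by (simp add: \<beta>_def)
    next
      assume *: "of_nat (Suc m') * (of_rat c - \<xi>) = of_nat (Suc k') * (\<xi> - of_rat a)"
      have "(of_nat (Suc m') :: rat) * (c - b) = of_nat (Suc k') * (b - a)"
        using q assms k by (simp add: mk' field_simps)
      then have "of_rat (of_nat (Suc m') * (c - b)) = (of_rat (of_nat (Suc k') * (b - a)) :: complex)"
        by (rule arg_cong)
      then have **: "of_nat (Suc m') * (of_rat c - of_rat b) =
          (of_nat (Suc k') * (of_rat b - of_rat a) :: complex)"
        by (simp add: of_rat_mult of_rat_diff of_rat_add)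
      have "(of_nat (Suc m') + of_nat (Suc k')) * (\<xi> - of_rat b) = 0"
        using * ** by (simp add: algebra_simps)
      moreover have "(of_nat (Suc m') + of_nat (Suc k') :: complex) \<noteq> 0"
        by (metis of_nat_add of_nat_eq_0_iff add_is_0 nat.distinct(1))
      ultimately have "\<xi> = of_rat b" by simp
      then show ?thesis using vals(2) by simp
    qed
  qed
qed

text \<open>Second half of the algorithm, by induction on the number of points:
  \<open>belyi_three_points\<close> gives two of them the same image. At most two points are handled
  by an affine map.\<close>

lemma belyi_rational_points:
  fixes S :: "rat set"
  assumes "finite S"
  obtains q :: "rat poly" where "degree q > 0" "\<And>s. s \<in> S \<Longrightarrow> poly q s \<in> {0, 1}"
    "\<And>\<xi>. poly (of_rat_poly (pderiv q)) \<xi> = 0 \<Longrightarrow> poly (of_rat_poly q) \<xi> \<in> {0, 1}"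
  using assms
proof (induction "card S" arbitrary: S thesis rule: less_induct)
  case less
  show ?case
  proof (cases "card S \<le> 2")
    case True
    obtain x y where xy: "S \<subseteq> {x, y}" "x \<noteq> y"
    proof (cases "card S = 2")
      case True
      then show ?thesis using that by (auto simp: card_2_iff)
    next
      case False
      with True have "card S \<le> Suc 0" by simp
      then obtain x where "S \<subseteq> {x}" using less.prems(2) by (metis card_le_Suc0_iff_eq subsetI insertCI singletonI)
      then show ?thesis using that[of x "x + 1"] by auto
    qed
    show ?thesis
      by (rule less.prems(1)[of "smult (inverse (y - x)) [:- x, 1:]"])
        (use xy in \<open>auto simp: pderiv_pCons field_simps of_rat_diff of_rat_inverse\<close>)
  next
    case False
    obtain a b c where abc: "a \<in> S" "b \<in> S" "c \<in> S" "a < b" "b < c"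
    proof -
      define a c where "a = Min S" and "c = Max S"
      have "S \<noteq> {}" using False by auto
      then have ac: "a \<in> S" "c \<in> S" using less.prems(2) by (auto simp: a_def c_def)
      have "card {a, c} < card S" using False card_insert_le_m1[of 2 "{c}" a] by simp
      then obtain b where b: "b \<in> S" "b \<notin> {a, c}"
        by (metis card_mono finite.emptyI finite_insert leD subsetI)
      then have "a \<le> b" "b \<le> c" using less.prems(2) by (auto simp: a_def c_def)
      with b ac show ?thesis using that by force
    qed
    obtain \<beta> :: "rat poly" where \<beta>: "degree \<beta> > 0" "poly \<beta> a = 0" "poly \<beta> b = 1" "poly \<beta> c = 0"
      "\<And>\<xi>. poly (of_rat_poly (pderiv \<beta>)) \<xi> = 0 \<Longrightarrow> poly (of_rat_poly \<beta>) \<xi> \<in> {0, 1}"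
      using belyi_three_points[OF abc(4,5)] by blast
    have "\<not> inj_on (poly \<beta>) S" 
      using abc \<beta>(2,4) by (metis inj_onD order_less_trans order_less_irrefl)
    then have "card (poly \<beta> ` S) < card S"
      using less.prems(2) by (meson card_image_le eq_card_imp_inj_on le_neq_implies_less)
    from less.hyps[OF this] obtain q where q: "degree q > 0"
      "\<And>s. s \<in> poly \<beta> ` S \<Longrightarrow> poly q s \<in> {0, 1}"
      "\<And>\<xi>. poly (of_rat_poly (pderiv q)) \<xi> = 0 \<Longrightarrow> poly (of_rat_poly q) \<xi> \<in> {0, 1}"
      using less.prems(2) by blast
    \<comment> \<open>0 and 1 are the values of \<beta> at a and b, so they belong to the smaller
      set; this is what controls the critical values of \<beta>.\<close>
    have q01: "poly q 0 \<in> {0, 1}" "poly q 1 \<in> {0, 1}"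
      using q(2) abc \<beta> by (metis image_eqI)+
    have q01': "poly (of_rat_poly q) x \<in> {0, 1}" if "x \<in> {0, 1}" for x
      using that q01 poly_of_rat_poly[of q 0] poly_of_rat_poly[of q 1] by auto
    show ?thesis
    proof (rule less.prems(1)[of "pcompose q \<beta>"])
      show "degree (pcompose q \<beta>) > 0" using q(1) \<beta>(1) by (simp add: degree_pcompose)
      show "poly (pcompose q \<beta>) s \<in> {0, 1}" if "s \<in> S" for s
        using q(2) that by (simp add: poly_pcompose)
      show "poly (of_rat_poly (pcompose q \<beta>)) \<xi> \<in> {0, 1}"
        if "poly (of_rat_poly (pderiv (pcompose q \<beta>))) \<xi> = 0" for \<xi>
      proof -
        have "poly (of_rat_poly (pderiv q)) (poly (of_rat_poly \<beta>) \<xi>) = 0 \<or>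
            poly (of_rat_poly (pderiv \<beta>)) \<xi> = 0"
          using that by (simp add: pderiv_pcompose of_rat_poly_pcompose poly_pcompose)
        then show ?thesis
          using q(3) \<beta>(5) q01' by (metis of_rat_poly_pcompose poly_pcompose)
      qed
    qed
  qed
qed

text \<open>The two halves combined: h makes the relevant values rational, and finitely many of them
  remain to be sent to {0, 1}. The critical points of h are among the points treated, since they
  stay critical in the composite.\<close>

lemma belyi_algebraic_points:
  fixes P :: "rat poly"
  assumes "P \<noteq> 0"
  obtains q :: "rat poly" where "degree q > 0"
    "\<And>\<xi>. poly (of_rat_poly P) \<xi> = 0 \<Longrightarrow> poly (of_rat_poly q) \<xi> \<in> {0, 1}"
    "\<And>\<xi>. poly (of_rat_poly (pderiv q)) \<xi> = 0 \<Longrightarrow> poly (of_rat_poly q) \<xi> \<in> {0, 1}"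
proof -
  obtain h :: "rat poly" where h: "degree h > 0"
    "\<And>\<xi>. poly (of_rat_poly P) \<xi> = 0 \<Longrightarrow> poly (of_rat_poly h) \<xi> \<in> \<rat>"
    "\<And>\<xi>. poly (of_rat_poly (pderiv h)) \<xi> = 0 \<Longrightarrow> poly (of_rat_poly h) \<xi> \<in> \<rat>"
    using rational_critical_values[OF assms] by blast
  define Z where "Z = {\<xi>. poly (of_rat_poly P) \<xi> = 0} \<union> {\<xi>. poly (of_rat_poly (pderiv h)) \<xi> = 0}"
  have "pderiv h \<noteq> 0" using h(1) by (simp add: pderiv_eq_0_iff)
  then have "finite Z" using assms unfolding Z_def by (auto intro!: poly_roots_finite)
  define S where "S = {s::rat. of_rat s \<in> poly (of_rat_poly h) ` Z}"
  have "of_rat ` S \<subseteq> poly (of_rat_poly h) ` Z" by (auto simp: S_def)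
  then have "finite S"
    using \<open>finite Z\<close> by (metis finite_imageD finite_imageI finite_subset inj_onI of_rat_eq_iff)
  then obtain q where q: "degree q > 0" "\<And>s. s \<in> S \<Longrightarrow> poly q s \<in> {0, 1}"
    "\<And>\<xi>. poly (of_rat_poly (pderiv q)) \<xi> = 0 \<Longrightarrow> poly (of_rat_poly q) \<xi> \<in> {0, 1}"
    using belyi_rational_points by blast
  have Z: "poly (of_rat_poly (pcompose q h)) \<xi> \<in> {0, 1}" if "\<xi> \<in> Z" for \<xi>
  proof -
    have "poly (of_rat_poly h) \<xi> \<in> \<rat>" using that h(2,3) by (auto simp: Z_def)
    then obtain s where s: "poly (of_rat_poly h) \<xi> = of_rat s" by (elim Rats_cases)
    then have "s \<in> S" using that by (auto simp: S_def intro!: image_eqI[of _ _ \<xi>])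
    from q(2)[OF this] show ?thesis by (auto simp: of_rat_poly_pcompose poly_pcompose s)
  qed
  show ?thesis
  proof (rule that[of "pcompose q h"])
    show "degree (pcompose q h) > 0" using q(1) h(1) by (simp add: degree_pcompose)
    show "poly (of_rat_poly (pcompose q h)) \<xi> \<in> {0, 1}" if "poly (of_rat_poly P) \<xi> = 0" for \<xi>
      using that by (intro Z) (simp add: Z_def)
    show "poly (of_rat_poly (pcompose q h)) \<xi> \<in> {0, 1}"
      if "poly (of_rat_poly (pderiv (pcompose q h))) \<xi> = 0" for \<xi>
    proof (cases "\<xi> \<in> Z")
      case False
      then have "poly (of_rat_poly (pderiv q)) (poly (of_rat_poly h) \<xi>) = 0"
        using that by (simp add: Z_def pderiv_pcompose of_rat_poly_pcompose poly_pcompose)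
      from q(3)[OF this] show ?thesis by (simp add: of_rat_poly_pcompose poly_pcompose)
    qed (rule Z)
  qed
qed


section \<open>Lenstra's cancellation lemma and clean Belyi polynomials\<close>

text \<open>Write q = a x^n + lower terms. Comparing leading coefficients gives c with c^n = 1 such
  that r and c p have the same leading coefficient. If s = r - c p were not constant, then r^n - p^n
  = s G with G of degree at least (n-1) deg p, a degree too large to be compensated by the lower
  terms of q.\<close>

lemma pcompose_eq_imp_affine:
  fixes p q r :: "'a::field_char_0 poly"
  assumes "degree q > 0" "degree p > 0" "degree r = degree p" "pcompose q p = pcompose q r"
  obtains c e where "c \<noteq> 0" "r = smult c p + [:e:]"
proof -
  define n d a c where "n = degree q" and "d = degree p" and "a = lead_coeff q"
    and "c = lead_coeff r / lead_coeff p"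
  have n: "n > 0" and d: "d > 0" using assms by (auto simp: n_def d_def)
  have [simp]: "p \<noteq> 0" "r \<noteq> 0" "q \<noteq> 0" using assms by auto
  have a: "a \<noteq> 0" and c: "c \<noteq> 0" by (simp_all add: a_def c_def)
  have "a * lead_coeff p ^ n = a * lead_coeff r ^ n"
    using lead_coeff_comp[of p q] lead_coeff_comp[of r q] assms
    by (simp add: a_def n_def)
  then have cn: "c ^ n = 1" using a by (simp add: c_def power_divide)
  define s where "s = r - smult c p"
  define q1 where "q1 = q - monom a n"
  define G where "G = (\<Sum>i<n. smult c p ^ (n - Suc i) * r ^ i)"
  have lcp: "lead_coeff (smult c p) = lead_coeff r" "degree (smult c p) = d" "degree r = d"
    using c assms by (simp_all add: c_def d_def)
  have "degree s = 0"
  proof (rule ccontr)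
    assume s: "degree s \<noteq> 0"
    have q1: "degree q1 \<le> n - 1"
    proof (rule degree_le, intro allI impI)
      fix i assume "n - 1 < i"
      then show "coeff q1 i = 0"
        by (cases "i = n") (auto simp: q1_def a_def n_def coeff_eq_0)
    qed
    have "smult a (r ^ n - p ^ n) = pcompose q1 p - pcompose q1 r"
      using assms(4) by (simp add: q1_def pcompose_diff pcompose_monom smult_diff_right)
    moreover have "r ^ n - p ^ n = s * G"
    proof -
      have "p ^ n = smult c p ^ n" by (simp add: smult_power cn)
      then show ?thesis unfolding s_def G_def by (simp only: power_diff_sumr2)
    qed
    ultimately have eq: "smult a (s * G) = pcompose q1 p - pcompose q1 r" by simp
    have "coeff (smult c p ^ (n - Suc i) * r ^ i) ((n - 1) * d) = lead_coeff r ^ (n - 1)"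
      if "i < n" for i
    proof -
      have "degree (smult c p ^ (n - Suc i) * r ^ i) = (n - Suc i) * d + i * d"
        using lcp c by (simp add: degree_mult_eq degree_power_eq)
      also have "\<dots> = (n - 1) * d"
        using that by (simp flip: add_mult_distrib)
      finally have "coeff (smult c p ^ (n - Suc i) * r ^ i) ((n - 1) * d) =
          lead_coeff (smult c p ^ (n - Suc i) * r ^ i)" by (simp only:)
      also have "\<dots> = lead_coeff r ^ (n - Suc i + i)"
        unfolding lead_coeff_mult lead_coeff_power lcp(1) power_add ..
      also have "n - Suc i + i = n - 1" using that by simp
      finally show ?thesis .
    qed
    \<comment> \<open>All n summands have the same leading coefficient, so in characteristic zero
      they cannot cancel.\<close>
    then have "coeff G ((n - 1) * d) = of_nat n * lead_coeff r ^ (n - 1)"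
      by (simp add: G_def coeff_sum)
    then have G: "coeff G ((n - 1) * d) \<noteq> 0" using n by simp
    then have "(n - 1) * d \<le> degree G" by (rule le_degree)
    moreover have "degree (smult a (s * G)) = degree s + degree G"
    proof -
      have "s \<noteq> 0" "G \<noteq> 0" using s G by auto
      then show ?thesis using a by (simp add: degree_mult_eq)
    qed
    moreover have "degree (pcompose q1 p - pcompose q1 r) \<le> (n - 1) * d"
      using q1 assms(3) by (intro degree_diff_le) (auto simp: degree_pcompose d_def)
    ultimately show False using s eq by simp
  qed
  then obtain e where "s = [:e:]" by (elim degree_eq_zeroE)
  then show ?thesis using that[OF c, of e] by (simp add: s_def algebra_simps)
qed

lemma pcompose_power: "pcompose (p ^ n) r = pcompose p r ^ n"
  by (induction n) (simp_all add: pcompose_mult pcompose_1)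

lemma order_pcompose_linear:
  fixes p :: "'a::field poly"
  assumes "a \<noteq> 0" "p \<noteq> 0"
  shows "order x (pcompose p [:b, a:]) = order (a * x + b) p"
proof -
  define y n where "y = a * x + b" and "n = order y p"
  obtain q where q: "p = [:- y, 1:] ^ n * q" "\<not> [:- y, 1:] dvd q"
    using order_decomp[OF assms(2)] unfolding n_def by blast
  have "pcompose [:- y, 1:] [:b, a:] = smult a [:- x, 1:]"
    by (simp add: y_def pcompose_pCons)
  then have "pcompose p [:b, a:] = smult (a ^ n) ([:- x, 1:] ^ n * pcompose q [:b, a:])"
    by (subst q(1)) (simp only: pcompose_mult pcompose_power smult_power mult_smult_left)
  moreover have "poly (pcompose q [:b, a:]) x \<noteq> 0"
    using q(2) by (simp add: poly_pcompose poly_eq_0_iff_dvd y_def algebra_simps)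
  moreover from this have "order x (pcompose q [:b, a:]) = 0" "pcompose q [:b, a:] \<noteq> 0"
    by (auto intro: order_0I)
  ultimately show ?thesis
    using assms(1) by (simp add: order_smult order_mult order_power_n_n n_def y_def)
qed

section \<open>Polynomials with algebraic coefficients\<close>

definition Qbar_polys :: "complex poly set" where
  "Qbar_polys = {p. \<forall>i. coeff p i \<in> Qbar}"

lemma Qbar_sum [intro]: "(\<And>i. i \<in> A \<Longrightarrow> f i \<in> Qbar) \<Longrightarrow> sum f A \<in> Qbar"
  by (induction A rule: infinite_finite_induct) auto

lemma Qbar_polys_pCons [simp]: "pCons a p \<in> Qbar_polys \<longleftrightarrow> a \<in> Qbar \<and> p \<in> Qbar_polys"
  unfolding Qbar_polys_def by (auto simp: coeff_pCons split: nat.split_asm nat.split)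

lemma Qbar_polys_0 [simp]: "0 \<in> Qbar_polys"
  and Qbar_polys_add [intro]: "p \<in> Qbar_polys \<Longrightarrow> q \<in> Qbar_polys \<Longrightarrow> p + q \<in> Qbar_polys"
  and Qbar_polys_mult [intro]: "p \<in> Qbar_polys \<Longrightarrow> q \<in> Qbar_polys \<Longrightarrow> p * q \<in> Qbar_polys"
  and Qbar_polys_of_rat [simp]: "of_rat_poly r \<in> Qbar_polys"
  by (auto simp: Qbar_polys_def coeff_mult)

lemma Qbar_polys_pderiv [intro]: "p \<in> Qbar_polys \<Longrightarrow> pderiv p \<in> Qbar_polys"
  by (induction p) (auto simp: pderiv_pCons)

lemma Qbar_polys_pcompose [intro]:
  "p \<in> Qbar_polys \<Longrightarrow> q \<in> Qbar_polys \<Longrightarrow> pcompose p q \<in> Qbar_polys"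
  by (induction p) (auto simp: pcompose_pCons)

lemma poly_in_Qbar [intro]: "p \<in> Qbar_polys \<Longrightarrow> x \<in> Qbar \<Longrightarrow> poly p x \<in> Qbar"
  by (induction p) auto

lemma Qbar_root: "p \<in> Qbar_polys \<Longrightarrow> p \<noteq> 0 \<Longrightarrow> poly p x = 0 \<Longrightarrow> x \<in> Qbar"
  using algebraic_root[of p x] by (simp add: Qbar_polys_def Qbar_def)

lemma Qbar_rat_poly:
  assumes "x \<in> Qbar"
  obtains p where "p \<noteq> 0" "poly (of_rat_poly p) x = 0"
proof -
  obtain r where r: "\<And>i. coeff r i \<in> \<rat>" "r \<noteq> 0" "poly r x = 0"
    using assms unfolding Qbar_def mem_Collect_eq algebraic_altdef by blast
  obtain p where "r = of_rat_poly p"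
    using ratpolyE[OF r(1)] unfolding of_rat_poly_def by blast
  then show ?thesis using that r by auto
qed

lemma order_eq_1_iff:
  fixes p :: "'a::field_char_0 poly"
  assumes "p \<noteq> 0"
  shows "order x p = 1 \<longleftrightarrow> poly p x = 0 \<and> poly (pderiv p) x \<noteq> 0"
proof (cases "poly p x = 0")
  case True
  have "pderiv p \<noteq> 0"
  proof
    assume "pderiv p = 0"
    then have "degree p = 0" by (simp add: pderiv_eq_0_iff)
    with True assms show False by (auto elim!: degree_eq_zeroE)
  qed
  then show ?thesis
    using order_pderiv[OF assms True] order_root[of "pderiv p" x] True by auto
qed (simp add: order_0I)

text \<open>The critical values of p are algebraic, so a product of rational polynomials
  \<open>R c\<close> vanishes at all of them, and Belyi's algorithm is run on this product. The
  resulting g has critical values in {0, 1}; one more folding makes it clean.\<close>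

lemma belyi_polynomial_from_algebraic:
  assumes p: "p \<in> Qbar_polys" "degree p \<ge> 2"
  obtains Q where "degree Q > 0" "belyi_polynomial (pcompose (of_rat_poly Q) p)"
proof -
  define C where "C = {c. poly (pderiv p) c = 0}"
  have p': "pderiv p \<noteq> 0" using p(2) by (simp add: pderiv_eq_0_iff)
  then have "finite C" unfolding C_def by (rule poly_roots_finite)
  have "poly p c \<in> Qbar" if "c \<in> C" for c
    using that p(1) Qbar_root[OF _ p', of c] by (auto simp: C_def)
  then have "\<forall>c\<in>C. \<exists>R. R \<noteq> 0 \<and> poly (of_rat_poly R) (poly p c) = 0"
    by (metis Qbar_rat_poly)
  then obtain R where R: "\<And>c. c \<in> C \<Longrightarrow> R c \<noteq> 0"
      "\<And>c. c \<in> C \<Longrightarrow> poly (of_rat_poly (R c)) (poly p c) = 0"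
    by metis
  have "prod R C \<noteq> 0" using R(1) \<open>finite C\<close> by simp
  then obtain q where q: "degree q > 0"
    "\<And>\<xi>. poly (of_rat_poly (prod R C)) \<xi> = 0 \<Longrightarrow> poly (of_rat_poly q) \<xi> \<in> {0, 1}"
    "\<And>\<xi>. poly (of_rat_poly (pderiv q)) \<xi> = 0 \<Longrightarrow> poly (of_rat_poly q) \<xi> \<in> {0, 1}"
    using belyi_algebraic_points by blast
  define g where "g = pcompose (of_rat_poly q) p"
  have "degree g = degree q * degree p" by (simp add: g_def degree_pcompose)
  moreover have "1 * 2 \<le> degree q * degree p" using q(1) p(2) by (intro mult_le_mono) auto
  ultimately have deg_g: "degree g \<ge> 2" by simp
  have crit_g: "poly g z \<in> {0, 1}" if z: "poly (pderiv g) z = 0" for z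
  proof (cases "z \<in> C")
    case True
    have "of_rat_poly (prod R C) = of_rat_poly (R z) * of_rat_poly (prod R (C - {z}))"
      by (subst prod.remove[OF \<open>finite C\<close> True]) simp
    then have "poly (of_rat_poly (prod R C)) (poly p z) = 0" using R(2)[OF True] by simp
    from q(2)[OF this] show ?thesis by (simp add: g_def poly_pcompose)
  next
    case False
    then have "poly (of_rat_poly (pderiv q)) (poly p z) = 0"
      using z by (simp add: g_def C_def pderiv_pcompose poly_pcompose of_rat_poly_pderiv)
    from q(3)[OF this] show ?thesis by (simp add: g_def poly_pcompose)
  qed
  \<comment> \<open>The fold x -> 4x(1-x) sends 0 and 1 to 0, and its only critical point 1/2 to 1.
    The points over 1 are then those with g = 1/2, which are not critical for g, so each has
    multiplicity exactly 2.\<close>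
  define Q where "Q = pcompose [:0, 4, - 4:] q"
  define f where "f = pcompose (of_rat_poly Q) p"
  have f: "f = pcompose [:0, 4, - 4:] g"
    by (simp add: f_def Q_def g_def of_rat_poly_pcompose pcompose_assoc of_rat_minus)
  have poly_f: "poly f z = 4 * poly g z * (1 - poly g z)" for z
    by (simp add: f poly_pcompose algebra_simps)
  have deg_f: "degree f = 2 * degree g" by (simp add: f degree_pcompose)
  have df: "poly (pderiv f) z = 4 * (1 - 2 * poly g z) * poly (pderiv g) z" for z
    by (simp add: f pderiv_pcompose poly_pcompose pderiv_pCons algebra_simps)
  have "belyi_polynomial f"
    unfolding belyi_polynomial_def
  proof (intro conjI allI impI)
    have "f \<in> Qbar_polys" using p(1) by (auto simp: f_def)
    then show "coeff f i \<in> Qbar" for i by (simp add: Qbar_polys_def)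
    show "degree f \<ge> 3" using deg_f deg_g by simp
    fix z
    show "poly f z \<in> {0, 1}" if "poly (pderiv f) z = 0"
    proof -
      consider "poly g z = 1 / 2" | "poly g z \<in> {0, 1}"
        using \<open>poly (pderiv f) z = 0\<close> crit_g[of z] by (auto simp: df field_simps)
      then show ?thesis
      proof cases
        case 1
        have "poly f z = 4 * (1 / 2) * (1 - 1 / 2)" by (simp only: poly_f 1)
        then show ?thesis by simp
      qed (auto simp: poly_f)
    qed
    assume z: "poly f z = 1"
    \<comment> \<open>1 - f is the square of this \<open>u\<close>, so cleanness becomes simplicity
      of the roots of \<open>u\<close>.\<close>
    define u where "u = smult 2 g - 1"
    have "poly (f - [:1:]) = poly (- (u * u))"
      by (simp add: fun_eq_iff poly_f u_def algebra_simps)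
    then have fu: "f - [:1:] = - (u * u)" by (simp only: poly_eq_poly_eq_iff)
    have "poly u z * poly u z = 0" using arg_cong[OF fu, of "\<lambda>h. poly h z"] z by simp
    then have uz: "poly u z = 0" by simp
    then have "poly g z = 1 / 2" by (simp add: u_def field_simps)
    then have "poly (pderiv g) z \<noteq> 0" using crit_g[of z] by auto
    then have "poly (pderiv u) z \<noteq> 0" by (simp add: u_def pderiv_diff pderiv_smult)
    moreover from this have "u \<noteq> 0" by auto
    ultimately have "order z u = 1" "u \<noteq> 0" using uz order_eq_1_iff[of u z] by auto
    then show "order z (f - [:1:]) = 2"
      by (simp add: fu order_mult)
  qed
  moreover have "degree Q > 0" using q(1) by (simp add: Q_def degree_pcompose)
  ultimately show ?thesis using that unfolding f_def by blast
qed

text \<open>An antiderivative of \<open>z\<^sup>3 (z - 1)\<^sup>2 (z - \<alpha>)\<close>: the different multiplicities of its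
  critical points make \<open>\<alpha>\<close> an invariant of the affine class.\<close>

definition lenstra_poly :: "complex \<Rightarrow> complex poly" where
  "lenstra_poly \<alpha> = [:0, 0, 0, 0, - \<alpha> / 4, (1 + 2 * \<alpha>) / 5, - (2 + \<alpha>) / 6, 1 / 7:]"

lemma degree_lenstra_poly [simp]: "degree (lenstra_poly \<alpha>) = 7"
  by (simp add: lenstra_poly_def)

text \<open>The first factor is written with \<open>- 0\<close> so that all three have the form
  \<open>[:- x, 1:]\<close>.\<close>

lemma pderiv_lenstra_poly:
  "pderiv (lenstra_poly \<alpha>) = [:- 0, 1:] ^ 3 * [:- 1, 1:] ^ 2 * [:- \<alpha>, 1:]"
  by (simp add: lenstra_poly_def pderiv_pCons power_numeral_reduce field_simps)

lemma order_pderiv_lenstra_poly: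
  "order y (pderiv (lenstra_poly \<alpha>)) =
     (if y = 0 then 3 else 0) + (if y = 1 then 2 else 0) + (if y = \<alpha> then 1 else 0)"
proof -
  have lin: "order y ([:- x, 1:] ^ n) = (if y = x then n else 0)" for x :: complex and n
    by (auto simp: order_power_n_n intro!: order_0I)
  have mult: "order y (p * q * r) = order y p + order y q + order y r"
    if "p \<noteq> 0" "q \<noteq> 0" "r \<noteq> 0" for p q r :: "complex poly"
    using that by (simp add: order_mult)
  show ?thesis
    unfolding pderiv_lenstra_poly using lin[of _ 1] by (subst mult) (simp_all only: lin power_one_right, auto)
qed

lemma lenstra_poly_affine_invariant:
  assumes "\<alpha> \<notin> {0, 1}" "\<beta> \<notin> {0, 1}" "degree q > 0" "a \<noteq> 0"
    and eq: "pcompose q (lenstra_poly \<alpha>) = pcompose (pcompose q (lenstra_poly \<beta>)) [:b, a:]"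
  shows "\<alpha> = \<beta>"
proof -
  let ?r = "pcompose (lenstra_poly \<beta>) [:b, a:]"
  have "degree ?r = degree (lenstra_poly \<alpha>)" using assms(4) by (simp add: degree_pcompose)
  moreover have "pcompose q (lenstra_poly \<alpha>) = pcompose q ?r"
    using eq by (simp add: pcompose_assoc)
  ultimately obtain c e where c: "c \<noteq> 0" and r: "?r = smult c (lenstra_poly \<alpha>) + [:e:]"
    using pcompose_eq_imp_affine[OF assms(3), of "lenstra_poly \<alpha>" ?r] by auto
  \<comment> \<open>Differentiation removes the additive constant, and nonzero scalars do not affect
    orders; what remains is that x -> ax + b matches the roots of the two derivatives.\<close>
  have "smult a (pcompose (pderiv (lenstra_poly \<beta>)) [:b, a:]) = smult c (pderiv (lenstra_poly \<alpha>))"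
    using arg_cong[OF r, of pderiv] 
    by (simp add: pderiv_pcompose pderiv_add pderiv_smult pderiv_pCons)
  then have "order x (smult a (pcompose (pderiv (lenstra_poly \<beta>)) [:b, a:])) =
      order x (smult c (pderiv (lenstra_poly \<alpha>)))" for x by simp
  moreover have "pderiv (lenstra_poly \<beta>) \<noteq> 0" by (simp add: pderiv_eq_0_iff)
  ultimately have ord: "order (a * x + b) (pderiv (lenstra_poly \<beta>)) =
      order x (pderiv (lenstra_poly \<alpha>))" for x
    using assms(4) c by (simp add: order_smult order_pcompose_linear)
  \<comment> \<open>As \<alpha> and \<beta> avoid 0 and 1, each of the orders 3, 2, 1 occurs at one
    point only: 0 goes to 0, then 1 to 1, then \<alpha> to \<beta>.\<close>
  have "b = 0"
    using ord[of 0] assms(1,2) by (auto simp: order_pderiv_lenstra_poly split: if_splits)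
  moreover have "a = 1"
    using ord[of 1] assms(1,2) \<open>b = 0\<close> by (auto simp: order_pderiv_lenstra_poly split: if_splits)
  ultimately show ?thesis
    using ord[of \<alpha>] assms(1,2) by (auto simp: order_pderiv_lenstra_poly split: if_splits)
qed

lemma degree_eq_sum_order:
  fixes p :: "complex poly"
  assumes "p \<noteq> 0"
  shows "degree p = (\<Sum>z | poly p z = 0. order z p)"
proof -
  have "degree p = size (proots p)" by (simp add: size_proots_complex)
  also have "\<dots> = (\<Sum>z | poly p z = 0. order z p)"
    using assms by (simp add: size_multiset_overloaded_eq)
  finally show ?thesis .
qed

text \<open>The algebraic form of the fact that a tree has two ends. Cleanness makes the degree
  twice the number of white points, and counting critical points shows that there is one more black
  point than white ones. So the orders of the zeros sum to 2 \<open>card B\<close> - 2, and being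
  positive, at least two of them equal 1.\<close>

lemma belyi_two_simple_zeros:
  assumes "belyi_polynomial f"
  obtains z w where "z \<noteq> w" "poly f z = 0" "poly f w = 0"
    "poly (pderiv f) z \<noteq> 0" "poly (pderiv f) w \<noteq> 0"
proof -
  have deg: "degree f \<ge> 3" and crit: "\<And>c. poly (pderiv f) c = 0 \<Longrightarrow> poly f c \<in> {0, 1}"
    and clean: "\<And>z. poly f z = 1 \<Longrightarrow> order z (f - [:1:]) = 2"
    using assms by (auto simp: belyi_polynomial_def)
  define B W where "B = {z. poly f z = 0}" and "W = {z. poly f z = 1}"
  define E where "E = {z \<in> B. order z f = 1}"
  have [simp]: "f \<noteq> 0" using deg by auto
  have f': "pderiv f \<noteq> 0" using deg by (simp add: pderiv_eq_0_iff)
  have deg1: "degree (f - [:1:]) = degree f"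
    using deg degree_add_eq_left[of "- [:1:]" f] by (simp only: diff_conv_add_uminus) simp
  then have f1: "f - [:1:] \<noteq> 0" using deg by auto
  have W: "W = {z. poly (f - [:1:]) z = 0}" by (auto simp: W_def)
  have fin: "finite B" "finite W" unfolding B_def W by (intro poly_roots_finite f1; simp)+
  then have "finite E" by (simp add: E_def)
  have n0: "degree f = (\<Sum>z\<in>B. order z f)"
    unfolding B_def by (rule degree_eq_sum_order) simp
  have "degree f = (\<Sum>z\<in>W. order z (f - [:1:]))"
    unfolding W using degree_eq_sum_order[OF f1] deg1 by simp
  also have "\<dots> = (\<Sum>z\<in>W. 2)" by (rule sum.cong) (auto simp: W_def clean)
  finally have n1: "degree f = 2 * card W" by simp
  have ordB: "order z f = Suc (order z (pderiv f))" if "z \<in> B" for z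
    using that f' by (intro order_pderiv) (auto simp: B_def order_root)
  have ordW: "order z (pderiv f) = 1" if "z \<in> W" for z
    using order_pderiv[of "f - [:1:]" z] that f' f1 clean[of z]
    by (simp add: W_def pderiv_diff pderiv_pCons)
  have "degree f - 1 = (\<Sum>z | poly (pderiv f) z = 0. order z (pderiv f))"
    using degree_eq_sum_order[OF f'] by (simp add: degree_pderiv)
  also have "\<dots> = (\<Sum>z\<in>B \<union> W. order z (pderiv f))"
    using fin crit by (intro sum.mono_neutral_left) (auto simp: B_def W_def order_0I)
  also have "\<dots> = (\<Sum>z\<in>B. order z (pderiv f)) + (\<Sum>z\<in>W. order z (pderiv f))"
    using fin by (intro sum.union_disjoint) (auto simp: B_def W_def)
  also have "(\<Sum>z\<in>W. order z (pderiv f)) = card W" by (simp add: ordW)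
  finally have n2: "degree f - 1 = (\<Sum>z\<in>B. order z (pderiv f)) + card W" .
  have "(\<Sum>z\<in>B. order z f) = (\<Sum>z\<in>B. order z (pderiv f)) + card B"
    by (simp add: ordB sum_Suc)
  with n0 n1 n2 deg have card_B: "card B = card W + 1" by linarith
  have "2 * card B = (\<Sum>z\<in>B. 2)" by simp
  also have "\<dots> \<le> (\<Sum>z\<in>B. order z f + (if z \<in> E then 1 else 0))"
    using ordB by (intro sum_mono) (auto simp: E_def)
  also have "\<dots> = degree f + (\<Sum>z\<in>B. if z \<in> E then 1 else 0)"
    by (simp only: sum.distrib n0)
  also have "(\<Sum>z\<in>B. if z \<in> E then 1 else 0) = (\<Sum>z\<in>E. 1::nat)"
    by (rule sum.mono_neutral_cong_right) (use fin in \<open>auto simp: E_def\<close>)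
  finally have "card E \<ge> 2" using card_B n1 by simp
  then have "\<not> card E \<le> Suc 0" by simp
  then obtain z w where "z \<in> E" "w \<in> E" "z \<noteq> w"
    unfolding card_le_Suc0_iff_eq[OF \<open>finite E\<close>] by blast
  then show ?thesis
    using that[of z w] order_eq_1_iff[of f z] order_eq_1_iff[of f w] by (auto simp: E_def)
qed


section \<open>Edges at a zero of the polynomial\<close>

text \<open>In the parameter of the arc, a connected set containing the start and another point
  covers an initial interval, and two such intervals overlap. Hence two rays leaving a vertex along
  the same edge must meet.\<close>

lemma arc_germs_overlap:
  fixes g :: "real \<Rightarrow> 'a::t2_space"
  assumes g: "arc g" and A: "connected A" "A \<subseteq> path_image g" "pathstart g \<in> A" "A \<noteq> {pathstart g}"
    and B: "connected B" "B \<subseteq> path_image g" "pathstart g \<in> B" "B \<noteq> {pathstart g}"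
  obtains u where "u \<in> A" "u \<in> B" "u \<noteq> pathstart g"
proof -
  obtain h where h: "homeomorphism {0..1} (path_image g) g h"
    using homeomorphism_arc[OF g] by blast
  have h0: "h (pathstart g) = 0"
    using h by (simp add: pathstart_def homeomorphism_def)
  have init: "\<exists>s>0. {0..s} \<subseteq> h ` X"
    if X: "connected X" "X \<subseteq> path_image g" "pathstart g \<in> X" "X \<noteq> {pathstart g}" for X
  proof -
    have "continuous_on X h" using h X(2) by (meson continuous_on_subset homeomorphism_cont2)
    then have con: "connected (h ` X)" using X(1) by (rule connected_continuous_image)
    obtain x where x: "x \<in> X" "x \<noteq> pathstart g" using X by blast
    have "h x \<in> {0..1}" using h x X(2) unfolding homeomorphism_def by blast
    moreover have "h x \<noteq> 0"
      using h0 h x X(2,3) by (metis homeomorphism_apply2 subsetD)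
    ultimately have "h x > 0" by simp
    moreover have "{0..h x} \<subseteq> h ` X"
      using connected_contains_Icc[OF con] h0 X(3) x(1) by (metis image_eqI)
    ultimately show ?thesis by blast
  qed
  obtain s t where st: "s > 0" "{0..s} \<subseteq> h ` A" "t > 0" "{0..t} \<subseteq> h ` B"
    using init[OF A] init[OF B] by blast
  define m where "m = min s t"
  have "m \<in> h ` A" "m \<in> h ` B" "m > 0" using st by (auto simp: m_def)
  then obtain u v where uv: "u \<in> A" "v \<in> B" "h u = m" "h v = m" by auto
  then have "u = v" using h A(2) B(2) by (metis homeomorphism_apply2 subsetD)
  with uv show ?thesis using h0 \<open>m > 0\<close> by (intro that[of u]) auto
qed

text \<open>At a zero of order n the polynomial is the n-th power of a local coordinate: an n-th
  root g of the nonvanishing cofactor exists near z, and (w - z) g(w) has derivative g(z) at z,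
  which is nonzero, so it is locally invertible.\<close>

lemma poly_local_power:
  fixes f :: "complex poly"
  assumes "degree f > 0" "poly f z = 0"
  obtains n V \<epsilon> \<phi> \<psi> where "n > 0" "n = 1 \<longleftrightarrow> poly (pderiv f) z \<noteq> 0"
    "open V" "z \<in> V" "0 < \<epsilon>" "\<epsilon> \<le> 1" "homeomorphism V (ball 0 \<epsilon>) \<phi> \<psi>" "\<phi> z = 0"
    "\<And>u. u \<in> V \<Longrightarrow> poly f u = \<phi> u ^ n"
proof -
  let ?f = "poly f"
  have holf: "?f holomorphic_on UNIV" by (intro holomorphic_intros)
  have df: "deriv ?f z = poly (pderiv f) z" by (rule DERIV_imp_deriv) (rule poly_DERIV)
  define n where "n = (LEAST k. 0 < k \<and> (deriv ^^ k) ?f z \<noteq> 0)"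
  have "\<exists>k. 0 < k \<and> (deriv ^^ k) ?f z \<noteq> 0"
  proof (rule ccontr)
    assume "\<not> ?thesis"
    then have zero: "(deriv ^^ k) ?f z = 0" if "0 < k" for k using that by blast
    have "?f w = ?f z" for w
      by (intro holomorphic_fun_eq_const_on_connected[OF holf]) (simp_all add: zero connected_UNIV)
    then have "poly f = poly 0" using assms(2) by auto
    then show False using assms(1) by (simp only: poly_eq_poly_eq_iff) simp
  qed
  from LeastI_ex[OF this] have n: "n > 0" "(deriv ^^ n) ?f z \<noteq> 0" by (auto simp: n_def)
  have nmin: "(deriv ^^ i) ?f z = 0" if "0 < i" "i < n" for i
    using not_less_Least[of i] that unfolding n_def by blast
  have n1: "n = 1 \<longleftrightarrow> poly (pderiv f) z \<noteq> 0"
    using n nmin[of 1] df by (cases "n = 1") auto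
  obtain g r where r: "0 < r" and holg: "g holomorphic_on ball z r"
    and fg: "\<And>w. w \<in> ball z r \<Longrightarrow> ?f w - ?f z = ((w - z) * g w) ^ n"
    and g0: "\<And>w. w \<in> ball z r \<Longrightarrow> g w \<noteq> 0"
    by (blast intro: nmin holomorphic_factor_order_of_zero_strong[OF holf open_UNIV UNIV_I n])
  define \<phi> where "\<phi> w = (w - z) * g w" for w
  have hol\<phi>: "\<phi> holomorphic_on ball z r" unfolding \<phi>_def by (intro holomorphic_intros holg)
  have "(g has_field_derivative deriv g z) (at z)"
    using holg r by (intro holomorphic_derivI[of g "ball z r"]) auto
  then have "(\<phi> has_field_derivative g z) (at z)"
    unfolding \<phi>_def by (auto intro!: derivative_eq_intros)
  then have d\<phi>: "deriv \<phi> z \<noteq> 0" using g0[of z] r by (simp add: DERIV_imp_deriv)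
  have zr: "z \<in> ball z r" using r by simp
  obtain s where s: "s > 0" "ball z s \<subseteq> ball z r" "open (\<phi> ` ball z s)" "inj_on \<phi> (ball z s)"
    by (rule has_complex_derivative_locally_invertible[OF hol\<phi> zr open_ball d\<phi>]; rule that; assumption)
  obtain \<psi> where \<psi>: "\<psi> holomorphic_on \<phi> ` ball z s" "\<And>w. w \<in> ball z s \<Longrightarrow> \<psi> (\<phi> w) = w"
    by (rule holomorphic_has_inverse[OF holomorphic_on_subset[OF hol\<phi> s(2)] open_ball s(4)];
        rule that; assumption)
  have "\<phi> z = 0" by (simp add: \<phi>_def)
  then have "0 \<in> \<phi> ` ball z s" using s(1) by (metis centre_in_ball imageI)
  then obtain \<epsilon>' where \<epsilon>': "\<epsilon>' > 0" "ball 0 \<epsilon>' \<subseteq> \<phi> ` ball z s"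
    using s(3) open_contains_ball by metis
  \<comment> \<open>Capping the radius at 1 will keep the values \<open>t ^ n\<close> along a ray
    inside (0, 1).\<close>
  define \<epsilon> where "\<epsilon> = min \<epsilon>' 1"
  have \<epsilon>: "0 < \<epsilon>" "\<epsilon> \<le> 1" "ball 0 \<epsilon> \<subseteq> \<phi> ` ball z s" using \<epsilon>' by (auto simp: \<epsilon>_def)
  define V where "V = ball z s \<inter> \<phi> -` ball 0 \<epsilon>"
  have cont: "continuous_on (ball z s) \<phi>"
    using hol\<phi> s(2) by (meson continuous_on_subset holomorphic_on_imp_continuous_on)
  have hom: "homeomorphism V (ball 0 \<epsilon>) \<phi> \<psi>"
  proof (rule homeomorphismI)
    show "continuous_on V \<phi>" using cont by (rule continuous_on_subset) (auto simp: V_def)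
    show "continuous_on (ball 0 \<epsilon>) \<psi>"
      using \<psi>(1) \<epsilon>(3) by (meson continuous_on_subset holomorphic_on_imp_continuous_on)
    show "\<psi> ` ball 0 \<epsilon> \<subseteq> V"
    proof
      fix w assume "w \<in> \<psi> ` ball 0 \<epsilon>"
      then obtain y where y: "y \<in> ball 0 \<epsilon>" "w = \<psi> y" by blast
      then obtain v where "v \<in> ball z s" "y = \<phi> v" using \<epsilon>(3) by blast
      then show "w \<in> V" using y \<psi>(2) by (simp add: V_def)
    qed
    show "\<phi> (\<psi> y) = y" if "y \<in> ball 0 \<epsilon>" for y
      using that \<epsilon>(3) \<psi>(2) by auto
  qed (auto simp: V_def \<psi>(2))
  have openV: "open V"
    unfolding V_def using continuous_open_preimage[OF cont open_ball open_ball] .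
  have zV: "z \<in> V" using s(1) \<epsilon>(1) by (simp add: V_def \<phi>_def)
  have fu: "?f u = \<phi> u ^ n" if "u \<in> V" for u
    using fg[of u] that s(2) assms(2) by (auto simp: V_def \<phi>_def)
  show ?thesis
    by (rule that[OF n(1) n1 openV zV \<epsilon>(1,2) hom \<open>\<phi> z = 0\<close> fu])
qed

text \<open>The hypothesis \<open>dessin (dessin_of f)\<close> makes every edge at z an arc that
  starts there, so a single edge cannot leave z in two directions. The edges are not counted in
  general: for n > 1 it is enough to play two rays against each other.\<close>

lemma card_edges_at_dessin_of:
  assumes D: "dessin (dessin_of f)" and z: "poly f z = 0" and f: "degree f > 0"
  shows "card (edges_at (dessin_of f) z) = 1 \<longleftrightarrow> poly (pderiv f) z \<noteq> 0"
proof -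
  define F where "F = poly f -` (complex_of_real ` {0<..<1})"
  obtain n V \<epsilon> \<phi> \<psi> where n: "n > 0" "n = 1 \<longleftrightarrow> poly (pderiv f) z \<noteq> 0"
    and V: "open V" "z \<in> V" and \<epsilon>: "0 < \<epsilon>" "\<epsilon> \<le> 1"
    and hom: "homeomorphism V (ball 0 \<epsilon>) \<phi> \<psi>" and \<phi>z: "\<phi> z = 0"
    and f\<phi>: "\<And>u. u \<in> V \<Longrightarrow> poly f u = \<phi> u ^ n"
    using poly_local_power[OF f z] by metis
  \<comment> \<open>For an n-th root of unity \<zeta> the local coordinate runs along a straight
    radius, on which f takes the value \<open>t ^ n\<close>.\<close>
  define ray where "ray \<zeta> = (\<lambda>t. \<psi> (of_real t * \<zeta>)) ` {0<..<\<epsilon>}" for \<zeta>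
  have \<psi>0: "\<psi> 0 = z" using hom V(2) \<phi>z by (metis homeomorphism_apply1)
  have nrm: "norm \<zeta> = 1" if "\<zeta> ^ n = 1" for \<zeta> :: complex
  proof -
    have "norm \<zeta> ^ n = 1 ^ n" using that by (simp flip: norm_power)
    then show ?thesis using n(1) by (subst (asm) power_eq_iff_eq_base) auto
  qed
  have inV: "\<psi> (of_real t * \<zeta>) \<in> V" "\<phi> (\<psi> (of_real t * \<zeta>)) = of_real t * \<zeta>"
    if "\<zeta> ^ n = 1" "t \<in> {0..<\<epsilon>}" for t \<zeta>
  proof -
    have b: "of_real t * \<zeta> \<in> ball 0 \<epsilon>" using that(2) nrm[OF that(1)] by (simp add: norm_mult)
    show "\<psi> (of_real t * \<zeta>) \<in> V" "\<phi> (\<psi> (of_real t * \<zeta>)) = of_real t * \<zeta>"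
      using hom b by (auto simp: homeomorphism_def)
  qed
  have ray_F: "ray \<zeta> \<subseteq> F" if "\<zeta> ^ n = 1" for \<zeta>
  proof
    fix u assume "u \<in> ray \<zeta>"
    then obtain t where t: "0 < t" "t < \<epsilon>" "u = \<psi> (of_real t * \<zeta>)" by (auto simp: ray_def)
    then have fu: "poly f u = of_real (t ^ n)"
      using inV[OF that, of t] f\<phi> that by (simp add: power_mult_distrib)
    have "t ^ n < 1" using t \<epsilon> n(1) by (intro power_less_one_iff[THEN iffD2]) auto
    with t have "t ^ n \<in> {0<..<1}" by simp
    with fu show "u \<in> F" unfolding F_def vimage_eq by (rule image_eqI)
  qed
  have ray_ins: "insert z (ray \<zeta>) = (\<lambda>t. \<psi> (of_real t * \<zeta>)) ` {0..<\<epsilon>}" for \<zeta>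
  proof -
    have "{0..<\<epsilon>} = insert 0 {0<..<\<epsilon>}" using \<epsilon>(1) by auto
    then show ?thesis by (simp add: ray_def \<psi>0)
  qed
  have cont: "continuous_on {0..<\<epsilon>} (\<lambda>t. \<psi> (of_real t * \<zeta>))" if "\<zeta> ^ n = 1" for \<zeta>
    by (intro continuous_on_compose2[OF homeomorphism_cont2[OF hom]] continuous_intros)
      (auto simp: norm_mult nrm[OF that])
  have ray_con: "connected (ray \<zeta>)" "connected (insert z (ray \<zeta>))" if "\<zeta> ^ n = 1" for \<zeta>
    unfolding ray_ins unfolding ray_def
    by (rule connected_continuous_image[OF continuous_on_subset[OF cont[OF that]]]; auto)+
  have ray_ne: "ray \<zeta> \<noteq> {}" for \<zeta> using \<epsilon>(1) by (auto simp: ray_def)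
  have z_ray: "z \<notin> ray \<zeta>" if "\<zeta> ^ n = 1" for \<zeta>
    using ray_F[OF that] z by (auto simp: F_def)
  have z_cl: "z \<in> closure (ray \<zeta>)" if "\<zeta> ^ n = 1" for \<zeta>
  proof -
    \<comment> \<open>A connected set with more than one point has no isolated point, so z is a
      limit of the ray.\<close>
    have "z islimpt insert z (ray \<zeta>)"
      using ray_con(2)[OF that] ray_ne z_ray[OF that]
      by (intro connected_imp_perfect) auto
    then have "z islimpt ray \<zeta>" by (simp add: islimpt_insert)
    then show ?thesis by (simp add: closure_def)
  qed
  have comp: "\<exists>K\<in>components F. ray \<zeta> \<subseteq> K \<and> z \<in> closure K" if root: "\<zeta> ^ n = 1" for \<zeta>
  proof -
    have "F \<noteq> {}" using ray_F[OF root] ray_ne by blast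
    then obtain K where "K \<in> components F" "ray \<zeta> \<subseteq> K"
      using exists_component_superset[OF ray_F[OF root]] ray_con(1)[OF root] by blast
    then show ?thesis using z_cl[OF root] closure_mono by blast
  qed
  have edges: "edges_at (dessin_of f) z = {closure K |K. K \<in> components F \<and> z \<in> closure K}"
    by (auto simp: edges_at_def dessin_of_def F_def)
  show ?thesis
  proof (cases "n = 1")
    case True
    obtain K where K: "K \<in> components F" "ray 1 \<subseteq> K" "z \<in> closure K"
      using comp[of 1] by auto
    \<comment> \<open>An edge at z comes from a component that enters \<open>V\<close>; there f is
      the coordinate itself, so the component contains a point of the ray for \<zeta> = 1.\<close>
    have "K' = K" if K': "K' \<in> components F" "z \<in> closure K'" for K'
    proof -
      have "V \<inter> K' \<noteq> {}"
        using K'(2) V open_Int_closure_eq_empty[OF V(1), of K'] by blast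
      then obtain u where u: "u \<in> V" "u \<in> K'" by blast
      then have "u \<in> F" using K'(1) in_components_subset by blast
      then obtain t where t: "0 < t" "t < 1" "poly f u = of_real t" by (auto simp: F_def)
      then have "\<phi> u = of_real t" using f\<phi>[OF u(1)] True by simp
      moreover have "\<phi> u \<in> ball 0 \<epsilon>" using hom u(1) unfolding homeomorphism_def by blast
      moreover have "u = \<psi> (\<phi> u)" using hom u(1) by (simp add: homeomorphism_apply1)
      ultimately have "u \<in> ray 1" using t by (auto simp: ray_def)
      then show ?thesis using K(1,2) K'(1) u(2) by (metis components_nonoverlap disjoint_iff subsetD)
    qed
    then have "edges_at (dessin_of f) z = {closure K}" unfolding edges using K by blast
    then show ?thesis using True n(2) by simp
  next
    case False
    have "card (edges_at (dessin_of f) z) \<noteq> 1"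
    proof
      assume "card (edges_at (dessin_of f) z) = 1"
      then obtain e where e: "edges_at (dessin_of f) z = {e}" by (auto simp: card_1_singleton_iff)
      have ray_e: "insert z (ray \<zeta>) \<subseteq> e" if "\<zeta> ^ n = 1" for \<zeta>
      proof -
        obtain K where K: "K \<in> components F" "ray \<zeta> \<subseteq> K" "z \<in> closure K"
          using comp[OF \<open>\<zeta> ^ n = 1\<close>] by blast
        then have "closure K \<in> edges_at (dessin_of f) z" unfolding edges by blast
        then have "closure K = e" using e by simp
        then show ?thesis using K closure_subset by blast
      qed
      have "e \<in> edges (dessin_of f)" "z \<in> e" using e by (auto simp: edges_at_def)
      moreover have "\<forall>e\<in>edges (dessin_of f). \<exists>g. arc g \<and> path_image g = e \<and>
          pathstart g \<in> black (dessin_of f) \<and> pathfinish g \<in> white (dessin_of f) \<and>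
          e \<inter> vertices (dessin_of f) = {pathstart g, pathfinish g}"
        using D unfolding dessin_def plane_tree_def bicoloured_plane_graph_def
        by (elim conjE) assumption
      ultimately obtain g where g: "arc g" "path_image g = e" "pathfinish g \<in> white (dessin_of f)"
          "e \<inter> vertices (dessin_of f) = {pathstart g, pathfinish g}"
        by meson
      have "z \<in> vertices (dessin_of f)" using z by (simp add: vertices_def dessin_of_def)
      then have "z \<in> {pathstart g, pathfinish g}" using g(4) \<open>z \<in> e\<close> by blast
      moreover have "z \<noteq> pathfinish g" using g(3) z by (auto simp: dessin_of_def)
      ultimately have start: "pathstart g = z" by auto
      \<comment> \<open>A second direction: 2 pi / n lies in (0, pi] because n is at least 2, so its
        cosine is less than 1.\<close>
      define \<omega> where "\<omega> = cis (2 * pi / n)"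
      have n2: "n \<ge> 2" using False n(1) by simp
      have \<omega>n: "\<omega> ^ n = 1" using n(1) unfolding \<omega>_def Complex.DeMoivre by simp
      have "\<omega> \<noteq> 1"
      proof
        assume "\<omega> = 1"
        then have "cos (2 * pi / n) = 1" by (metis \<omega>_def cis.simps(1) one_complex.simps(1))
        moreover have "cos (2 * pi / n) < cos 0"
          using n2 by (intro cos_monotone_0_pi) (auto simp: field_simps)
        ultimately show False by simp
      qed
      have "connected (insert z (ray 1))" "connected (insert z (ray \<omega>))"
        "insert z (ray 1) \<noteq> {z}" "insert z (ray \<omega>) \<noteq> {z}"
        using ray_con(2)[of 1] ray_con(2)[OF \<omega>n] ray_ne z_ray[of 1] z_ray[OF \<omega>n] by auto
      then obtain u where u: "u \<in> insert z (ray 1)" "u \<in> insert z (ray \<omega>)" "u \<noteq> z"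
        using arc_germs_overlap[OF g(1), of "insert z (ray 1)" "insert z (ray \<omega>)"]
          ray_e[of 1] ray_e[OF \<omega>n] unfolding start g(2) by auto
      then obtain s t where st: "s \<in> {0<..<\<epsilon>}" "t \<in> {0<..<\<epsilon>}"
          "u = \<psi> (of_real s * 1)" "u = \<psi> (of_real t * \<omega>)"
        unfolding ray_def by auto
      \<comment> \<open>In the local coordinate the common point is both s and t \<omega>; norms
        force s = t, and then \<omega> = 1.\<close>
      then have eq: "of_real s = of_real t * \<omega>"
        using inV(2)[of 1 s] inV(2)[OF \<omega>n, of t] by simp
      then have "norm (of_real s :: complex) = norm (of_real t * \<omega>)" by simp
      then have "s = t" using st by (simp add: norm_mult \<omega>_def)
      then show False using eq st \<open>\<omega> \<noteq> 1\<close> by simp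
    qed
    then show ?thesis using False n(2) by blast
  qed
qed


section \<open>The Galois group acting on polynomials\<close>

text \<open>The restriction is there because elements of \<open>BijGroup\<close> are extensional. If
  two elements act alike, their quotient moves nothing and is therefore the identity.\<close>

lemma faithful_actionI:
  assumes G: "group G"
    and closed: "\<And>g x. g \<in> carrier G \<Longrightarrow> x \<in> X \<Longrightarrow> F g x \<in> X"
    and one: "\<And>x. x \<in> X \<Longrightarrow> F \<one>\<^bsub>G\<^esub> x = x"
    and mult: "\<And>g h x. g \<in> carrier G \<Longrightarrow> h \<in> carrier G \<Longrightarrow> x \<in> X \<Longrightarrow>
      F (g \<otimes>\<^bsub>G\<^esub> h) x = F g (F h x)"
    and moved: "\<And>g. g \<in> carrier G \<Longrightarrow> g \<noteq> \<one>\<^bsub>G\<^esub> \<Longrightarrow> \<exists>x\<in>X. F g x \<noteq> x"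
  shows "faithful_action G X (\<lambda>g. restrict (F g) X)"
proof -
  interpret group G by fact
  have inv: "F (inv\<^bsub>G\<^esub> g) (F g x) = x" "F g (F (inv\<^bsub>G\<^esub> g) x) = x"
    if "g \<in> carrier G" "x \<in> X" for g x
    using that mult[of "inv\<^bsub>G\<^esub> g" g x] mult[of g "inv\<^bsub>G\<^esub> g" x] one by simp_all
  have bij: "restrict (F g) X \<in> Bij X" if g: "g \<in> carrier G" for g
  proof -
    have "bij_betw (F g) X X"
      by (rule bij_betw_byWitness[of _ "F (inv\<^bsub>G\<^esub> g)"]) (use g inv closed in auto)
    then show ?thesis by (simp add: Bij_def bij_betw_restrict_eq)
  qed
  have "group_hom G (BijGroup X) (\<lambda>g. restrict (F g) X)"
  proof (intro group_hom.intro group_hom_axioms.intro G group_BijGroup homI)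
    show "restrict (F g) X \<in> carrier (BijGroup X)" if "g \<in> carrier G" for g
      using bij[OF that] by (simp add: BijGroup_def)
    show "restrict (F (g \<otimes>\<^bsub>G\<^esub> h)) X =
        restrict (F g) X \<otimes>\<^bsub>BijGroup X\<^esub> restrict (F h) X"
      if "g \<in> carrier G" "h \<in> carrier G" for g h
      using bij that closed mult by (auto simp: BijGroup_def compose_def intro!: restrict_ext)
  qed
  moreover have "inj_on (\<lambda>g. restrict (F g) X) (carrier G)"
  proof (rule inj_onI)
    fix g h assume gh: "g \<in> carrier G" "h \<in> carrier G"
      and eq: "restrict (F g) X = restrict (F h) X"
    have "F (inv\<^bsub>G\<^esub> h \<otimes>\<^bsub>G\<^esub> g) x = x" if "x \<in> X" for x
    proof -
      have "F g x = F h x" using fun_cong[OF eq, of x] that by simp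
      then show ?thesis using mult[of "inv\<^bsub>G\<^esub> h" g x] gh that inv(1)[OF gh(2) that] by simp
    qed
    then have "inv\<^bsub>G\<^esub> h \<otimes>\<^bsub>G\<^esub> g = \<one>\<^bsub>G\<^esub>"
      using moved[of "inv\<^bsub>G\<^esub> h \<otimes>\<^bsub>G\<^esub> g"] gh by blast
    then show "g = h" using gh by (metis inv_equality inv_inv inv_closed)
  qed
  ultimately show ?thesis
    by (intro faithful_action.intro group_action.intro faithful_action_axioms.intro)
qed

lemma galois_group_simps:
  "carrier galois_group = {\<sigma> \<in> Bij Qbar.
      (\<forall>x\<in>Qbar. \<forall>y\<in>Qbar. \<sigma> (x + y) = \<sigma> x + \<sigma> y) \<and>
      (\<forall>x\<in>Qbar. \<forall>y\<in>Qbar. \<sigma> (x * y) = \<sigma> x * \<sigma> y) \<and>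
      (\<forall>q\<in>\<rat>. \<sigma> q = q)}"
  "\<one>\<^bsub>galois_group\<^esub> = (\<lambda>x\<in>Qbar. x)"
  by (simp_all add: galois_group_def BijGroup_def)

lemma galois_group_mult:
  "\<sigma> \<in> carrier galois_group \<Longrightarrow> \<tau> \<in> carrier galois_group \<Longrightarrow>
    \<sigma> \<otimes>\<^bsub>galois_group\<^esub> \<tau> = compose Qbar \<sigma> \<tau>"
  by (simp add: galois_group_def BijGroup_def)

lemma group_galois_group: "group galois_group"
proof -
  let ?H = "carrier galois_group"
  have "subgroup ?H (BijGroup Qbar)"
  proof (rule subgroup.intro)
    show "?H \<subseteq> carrier (BijGroup Qbar)" by (auto simp: galois_group_simps BijGroup_def)
    show "\<one>\<^bsub>BijGroup Qbar\<^esub> \<in> ?H"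
      using Rats_subset_Qbar
      by (auto simp: galois_group_simps BijGroup_def id_Bij Qbar_add Qbar_mult)
    fix \<sigma> assume \<sigma>: "\<sigma> \<in> ?H"
    then have \<sigma>B: "\<sigma> \<in> Bij Qbar" by (simp add: galois_group_simps)
    have cl: "\<sigma> x \<in> Qbar" if "x \<in> Qbar" for x using Bij_imp_funcset[OF \<sigma>B] that by auto
    show "\<sigma> \<otimes>\<^bsub>BijGroup Qbar\<^esub> \<tau> \<in> ?H" if \<tau>: "\<tau> \<in> ?H" for \<tau>
    proof -
      have \<tau>B: "\<tau> \<in> Bij Qbar" using \<tau> by (simp add: galois_group_simps)
      have cl': "\<tau> x \<in> Qbar" if "x \<in> Qbar" for x using Bij_imp_funcset[OF \<tau>B] that by auto
      have "compose Qbar \<sigma> \<tau> \<in> ?H"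
        using \<sigma> \<tau> cl cl' Rats_subset_Qbar compose_Bij[OF \<sigma>B \<tau>B]
        unfolding galois_group_simps by (auto simp: compose_def Qbar_add Qbar_mult subset_iff)
      then show ?thesis using \<sigma>B \<tau>B by (simp add: BijGroup_def)
    qed
    have "inv_into Qbar \<sigma> q = q" if "q \<in> \<rat>" for q
    proof -
      have "\<sigma> q = q" using \<sigma> that by (simp add: galois_group_simps)
      moreover have "inj_on \<sigma> Qbar" using \<sigma>B by (simp add: Bij_def bij_betw_def)
      ultimately show ?thesis using that Rats_subset_Qbar by (metis inv_into_f_f subsetD)
    qed
    moreover have "inv_into Qbar \<sigma> (x + y) = inv_into Qbar \<sigma> x + inv_into Qbar \<sigma> y"
      if "x \<in> Qbar" "y \<in> Qbar" for x y
      by (rule Bij_inv_into_lemma[where g = "(+)", OF _ \<sigma>B _ that])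
        (use \<sigma> in \<open>auto simp: galois_group_simps\<close>)
    moreover have "inv_into Qbar \<sigma> (x * y) = inv_into Qbar \<sigma> x * inv_into Qbar \<sigma> y"
      if "x \<in> Qbar" "y \<in> Qbar" for x y
      by (rule Bij_inv_into_lemma[where g = "(*)", OF _ \<sigma>B _ that])
        (use \<sigma> in \<open>auto simp: galois_group_simps\<close>)
    ultimately show "inv\<^bsub>BijGroup Qbar\<^esub> \<sigma> \<in> ?H"
      using \<sigma>B Rats_subset_Qbar unfolding inv_BijGroup[OF \<sigma>B] galois_group_simps
      by (auto simp: restrict_inv_into_Bij Qbar_add Qbar_mult subset_iff)
  qed
  then have "group (BijGroup Qbar\<lparr>carrier := ?H\<rparr>)"
    by (rule subgroup.subgroup_is_group[OF _ group_BijGroup])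
  moreover have "BijGroup Qbar\<lparr>carrier := ?H\<rparr> = galois_group"
    unfolding galois_group_def by simp
  ultimately show ?thesis by simp
qed

section \<open>One automorphism acting on numbers and polynomials\<close>

locale galois_element =
  fixes \<sigma> :: "complex \<Rightarrow> complex"
  assumes \<sigma>: "\<sigma> \<in> carrier galois_group"
begin

lemma bij: "bij_betw \<sigma> Qbar Qbar"
  using \<sigma> by (simp add: galois_group_simps Bij_def)

lemma closed [simp, intro]: "x \<in> Qbar \<Longrightarrow> \<sigma> x \<in> Qbar"
  using bij by (auto simp: bij_betw_def)

lemma eq_iff: "x \<in> Qbar \<Longrightarrow> y \<in> Qbar \<Longrightarrow> \<sigma> x = \<sigma> y \<longleftrightarrow> x = y"
  using bij by (auto simp: bij_betw_def inj_on_def)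

lemma surj: "y \<in> Qbar \<Longrightarrow> \<exists>x\<in>Qbar. y = \<sigma> x"
  using bij by (auto simp: bij_betw_def)

lemma add: "x \<in> Qbar \<Longrightarrow> y \<in> Qbar \<Longrightarrow> \<sigma> (x + y) = \<sigma> x + \<sigma> y"
  and mult: "x \<in> Qbar \<Longrightarrow> y \<in> Qbar \<Longrightarrow> \<sigma> (x * y) = \<sigma> x * \<sigma> y"
  and of_rat [simp]: "\<sigma> (of_rat q) = of_rat q"
  using \<sigma> by (simp_all add: galois_group_simps)

lemma zero [simp]: "\<sigma> 0 = 0" and one [simp]: "\<sigma> 1 = 1" and numeral [simp]: "\<sigma> (numeral k) = numeral k"
  using of_rat[of 0] of_rat[of 1] of_rat[of "numeral k"] by simp_all

lemma eq_0_iff: "x \<in> Qbar \<Longrightarrow> \<sigma> x = 0 \<longleftrightarrow> x = 0"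
  using eq_iff[of x 0] by simp

lemma minus: "x \<in> Qbar \<Longrightarrow> \<sigma> (- x) = - \<sigma> x"
  using add[of x "- x"] by (simp add: eq_neg_iff_add_eq_0 add.commute Qbar_uminus)

lemma diff: "x \<in> Qbar \<Longrightarrow> y \<in> Qbar \<Longrightarrow> \<sigma> (x - y) = \<sigma> x - \<sigma> y"
  using add[of x "- y"] by (simp add: minus Qbar_uminus)

lemma divide: "x \<in> Qbar \<Longrightarrow> y \<in> Qbar \<Longrightarrow> \<sigma> (x / y) = \<sigma> x / \<sigma> y"
  using mult[of "x / y" y] eq_0_iff[of y] by (cases "y = 0") (auto simp: field_simps Qbar_divide)

lemma sum: "(\<And>i. i \<in> A \<Longrightarrow> f i \<in> Qbar) \<Longrightarrow> \<sigma> (sum f A) = (\<Sum>i\<in>A. \<sigma> (f i))"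
  by (induction A rule: infinite_finite_induct) (auto simp: add Qbar_sum)

lemma coeff_map [simp]: "coeff (map_poly \<sigma> p) i = \<sigma> (coeff p i)"
  by (simp add: coeff_map_poly)

lemma map_pCons [simp]: "map_poly \<sigma> (pCons a p) = pCons (\<sigma> a) (map_poly \<sigma> p)"
  by (intro poly_eqI) (simp add: coeff_pCons split: nat.split)

lemma map_closed [simp, intro]: "p \<in> Qbar_polys \<Longrightarrow> map_poly \<sigma> p \<in> Qbar_polys"
  by (auto simp: Qbar_polys_def)

lemma map_add: "p \<in> Qbar_polys \<Longrightarrow> q \<in> Qbar_polys \<Longrightarrow>
    map_poly \<sigma> (p + q) = map_poly \<sigma> p + map_poly \<sigma> q"
  by (intro poly_eqI) (simp add: add Qbar_polys_def)

lemma map_mult: "p \<in> Qbar_polys \<Longrightarrow> q \<in> Qbar_polys \<Longrightarrow>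
    map_poly \<sigma> (p * q) = map_poly \<sigma> p * map_poly \<sigma> q"
  by (intro poly_eqI) (simp add: coeff_mult sum mult Qbar_polys_def Qbar_mult)

lemma map_pcompose: "p \<in> Qbar_polys \<Longrightarrow> q \<in> Qbar_polys \<Longrightarrow>
    map_poly \<sigma> (pcompose p q) = pcompose (map_poly \<sigma> p) (map_poly \<sigma> q)"
  by (induction p)
    (simp_all add: pcompose_pCons map_add map_mult Qbar_polys_mult Qbar_polys_pcompose)

lemma map_pderiv: "p \<in> Qbar_polys \<Longrightarrow> map_poly \<sigma> (pderiv p) = pderiv (map_poly \<sigma> p)"
  by (induction p) (simp_all add: pderiv_pCons map_add Qbar_polys_pderiv)

lemma poly_map: "p \<in> Qbar_polys \<Longrightarrow> x \<in> Qbar \<Longrightarrow> poly (map_poly \<sigma> p) (\<sigma> x) = \<sigma> (poly p x)"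
  by (induction p) (simp_all add: add mult Qbar_mult poly_in_Qbar)

lemma map_of_rat_poly [simp]: "map_poly \<sigma> (of_rat_poly r) = of_rat_poly r"
  by (intro poly_eqI) simp

lemma map_eq_0_iff: "p \<in> Qbar_polys \<Longrightarrow> map_poly \<sigma> p = 0 \<longleftrightarrow> p = 0"
  by (auto simp: poly_eq_iff Qbar_polys_def eq_0_iff)

lemma degree_map: "p \<in> Qbar_polys \<Longrightarrow> degree (map_poly \<sigma> p) = degree p"
  by (cases "p = 0") (auto intro!: map_poly_degree_eq simp: Qbar_polys_def eq_0_iff)

text \<open>The Belyi conditions quantify over all complex points, while \<sigma> acts on
  \<open>Qbar\<close> only. Roots of a polynomial with algebraic coefficients are algebraic, hence
  values of \<sigma>, and this brings conditions on the conjugate polynomial back to the original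
  one.\<close>

lemma root_map:
  assumes "p \<in> Qbar_polys" "p \<noteq> 0" "poly (map_poly \<sigma> p) y = 0"
  obtains x where "x \<in> Qbar" "y = \<sigma> x" "poly p x = 0"
proof -
  have "y \<in> Qbar" using assms by (intro Qbar_root[of "map_poly \<sigma> p"]) (auto simp: map_eq_0_iff)
  then obtain x where x: "x \<in> Qbar" "y = \<sigma> x" using surj by blast
  then show ?thesis using that assms by (auto simp: poly_map eq_0_iff poly_in_Qbar)
qed

lemma map_lenstra_poly:
  assumes "\<alpha> \<in> Qbar"
  shows "map_poly \<sigma> (lenstra_poly \<alpha>) = lenstra_poly (\<sigma> \<alpha>)"
  using assms by (simp add: lenstra_poly_def add mult minus diff divide
      Qbar_add Qbar_mult Qbar_divide Qbar_uminus Qbar_diff)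

end

lemma lenstra_poly_in_Qbar_polys: "\<alpha> \<in> Qbar \<Longrightarrow> lenstra_poly \<alpha> \<in> Qbar_polys"
  by (simp add: lenstra_poly_def Qbar_add Qbar_mult Qbar_divide Qbar_uminus Qbar_diff)

text \<open>The order is expressed through derivatives because \<sigma> is compatible with
  evaluation and with \<open>pderiv\<close>.\<close>

lemma order_eq_2_iff:
  fixes p :: "'a::field_char_0 poly"
  assumes "pderiv p \<noteq> 0"
  shows "order x p = 2 \<longleftrightarrow>
    poly p x = 0 \<and> poly (pderiv p) x = 0 \<and> poly (pderiv (pderiv p)) x \<noteq> 0"
proof (cases "poly p x = 0")
  case True
  have "p \<noteq> 0" using assms by auto
  then show ?thesis
    using order_pderiv[OF \<open>p \<noteq> 0\<close> True] order_eq_1_iff[OF assms, of x] True by auto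
qed (simp add: order_0I)

context galois_element
begin

lemma belyi_polynomial_map:
  assumes f: "belyi_polynomial f"
  shows "belyi_polynomial (map_poly \<sigma> f)"
proof -
  have fQ: "f \<in> Qbar_polys" and deg: "degree f \<ge> 3"
    and crit: "\<And>c. poly (pderiv f) c = 0 \<Longrightarrow> poly f c \<in> {0, 1}"
    and clean: "\<And>z. poly f z = 1 \<Longrightarrow> order z (f - [:1:]) = 2"
    using f by (auto simp: belyi_polynomial_def Qbar_polys_def)
  have f': "pderiv f \<noteq> 0" using deg by (simp add: pderiv_eq_0_iff)
  have f'Q: "pderiv f \<in> Qbar_polys" "pderiv (pderiv f) \<in> Qbar_polys"
    using fQ by (auto intro: Qbar_polys_pderiv)
  define g where "g = f + [:- 1:]"
  have g: "g \<in> Qbar_polys" "f - [:1:] = g"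
    using fQ by (auto simp: g_def Qbar_uminus)
  have g0: "g \<noteq> 0" using deg by (auto simp: g_def eq_neg_iff_add_eq_0[symmetric])
  have mg: "map_poly \<sigma> f - [:1:] = map_poly \<sigma> g"
    using fQ by (simp add: g_def map_add minus Qbar_uminus)
  have dg: "pderiv g = pderiv f" by (simp add: g_def pderiv_add pderiv_pCons)
  show ?thesis
    unfolding belyi_polynomial_def
  proof (intro conjI allI impI)
    show "coeff (map_poly \<sigma> f) i \<in> Qbar" for i using fQ by (auto simp: Qbar_polys_def)
    show "3 \<le> degree (map_poly \<sigma> f)" using deg fQ by (simp add: degree_map)
    fix z
    show "poly (map_poly \<sigma> f) z \<in> {0, 1}" if "poly (pderiv (map_poly \<sigma> f)) z = 0"
    proof -
      have "poly (map_poly \<sigma> (pderiv f)) z = 0"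
        using \<open>poly (pderiv (map_poly \<sigma> f)) z = 0\<close> fQ by (simp add: map_pderiv)
      then obtain x where x: "x \<in> Qbar" "z = \<sigma> x" "poly (pderiv f) x = 0"
        using root_map[OF f'Q(1) f'] by blast
      then show ?thesis using crit[of x] fQ by (auto simp: poly_map)
    qed
    assume "poly (map_poly \<sigma> f) z = 1"
    then have "poly (map_poly \<sigma> g) z = 0" by (simp flip: mg)
    then obtain x where x: "x \<in> Qbar" "z = \<sigma> x" "poly g x = 0" using root_map[OF g(1) g0] by blast
    then have "order x g = 2" using clean[of x] g by (simp add: g_def)
    then have "poly (pderiv g) x = 0" "poly (pderiv (pderiv g)) x \<noteq> 0"
      using order_eq_2_iff[of g x] f' by (auto simp: dg)
    then have "order z (map_poly \<sigma> g) = 2"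
      using x f' f'Q g(1) unfolding dg
      by (subst order_eq_2_iff)
        (auto simp: map_pderiv[symmetric] dg map_eq_0_iff poly_map Qbar_polys_pderiv eq_0_iff poly_in_Qbar)
    then show "order z (map_poly \<sigma> f - [:1:]) = 2" by (simp only: mg)
  qed
qed

end


section \<open>The actions on classes\<close>

text \<open>The action on representatives, which induces \<open>belyi_action\<close> on
  classes.\<close>

definition galois_act :: "(complex \<Rightarrow> complex) \<Rightarrow> pointed_poly \<Rightarrow> pointed_poly" where
  "galois_act \<sigma> = (\<lambda>(f, z, w). (map_poly \<sigma> f, \<sigma> z, \<sigma> w))"

lemma belyi_polynomial_Qbar_polys: "belyi_polynomial f \<Longrightarrow> f \<in> Qbar_polys"
  by (simp add: belyi_polynomial_def Qbar_polys_def)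

text \<open>Wanted before \<sigma> is applied to the marked points: they are roots of f or of f - 1,
  whose coefficients are algebraic.\<close>

lemma normalized_belyi_Qbar:
  assumes "(f, z, w) \<in> normalized_belyi"
  shows "z \<in> Qbar" "w \<in> Qbar"
proof -
  have f: "belyi_polynomial f" and v: "poly f z \<in> {0, 1}" "poly f w \<in> {0, 1}"
    using assms by (auto simp: normalized_belyi_def)
  have fQ: "f \<in> Qbar_polys" using f by (rule belyi_polynomial_Qbar_polys)
  have "degree f \<noteq> 0" using f by (auto simp: belyi_polynomial_def)
  then have nz: "f + [:- c:] \<noteq> 0" for c by (auto simp: eq_neg_iff_add_eq_0[symmetric])
  have "x \<in> Qbar" if "poly f x \<in> {0, 1}" for x
  proof -
    have "poly f x \<in> Qbar" using that by auto
    then have "f + [:- poly f x:] \<in> Qbar_polys" using fQ by (auto simp: Qbar_uminus)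
    then show ?thesis using nz[of "poly f x"] by (rule Qbar_root) simp
  qed
  then show "z \<in> Qbar" "w \<in> Qbar" using v by blast+
qed

lemma equiv_belyi_iso: "equiv normalized_belyi belyi_iso"
proof (rule equivI)
  show "belyi_iso \<subseteq> normalized_belyi \<times> normalized_belyi" by (auto simp: belyi_iso_def)
  show "refl_on normalized_belyi belyi_iso"
  proof (rule refl_onI)
    fix x assume "x \<in> normalized_belyi"
    moreover obtain f z w where "x = (f, z, w)" by (cases x)
    moreover have "\<exists>a b. a \<noteq> 0 \<and> f = pcompose f [:b, a:] \<and> a * z + b = z \<and> a * w + b = w"
      by (rule exI[of _ 1], rule exI[of _ 0]) simp
    ultimately show "(x, x) \<in> belyi_iso" by (simp add: belyi_iso_def)
  qed
  show "sym belyi_iso"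
  proof (rule symI)
    fix x y assume xy: "(x, y) \<in> belyi_iso"
    obtain f1 z1 w1 f2 z2 w2 where x: "x = (f1, z1, w1)" and y: "y = (f2, z2, w2)"
      by (cases x, cases y) auto
    obtain a b where n: "x \<in> normalized_belyi" "y \<in> normalized_belyi"
      and a: "a \<noteq> 0" "f1 = pcompose f2 [:b, a:]" "a * z1 + b = z2" "a * w1 + b = w2"
      using xy by (auto simp: belyi_iso_def x y)
    have "pcompose f1 [:- b / a, 1 / a:] = pcompose f2 (pcompose [:b, a:] [:- b / a, 1 / a:])"
      by (simp add: a(2) pcompose_assoc)
    also have "pcompose [:b, a:] [:- b / a, 1 / a:] = [:0, 1:]"
      using a(1) by (simp add: pcompose_pCons)
    finally have "f2 = pcompose f1 [:- b / a, 1 / a:]" by simp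
    moreover have "1 / a * z2 + - b / a = z1" "1 / a * w2 + - b / a = w1"
      using a by (auto simp: field_simps)
    ultimately have "\<exists>a b. a \<noteq> 0 \<and> f2 = pcompose f1 [:b, a:] \<and> a * z2 + b = z1 \<and> a * w2 + b = w1"
      using a(1) by (intro exI[of _ "1 / a"] exI[of _ "- b / a"]) simp
    then show "(y, x) \<in> belyi_iso" using n by (simp add: belyi_iso_def x y)
  qed
  show "trans belyi_iso"
  proof (rule transI)
    fix x y u assume xy: "(x, y) \<in> belyi_iso" and yu: "(y, u) \<in> belyi_iso"
    obtain f1 z1 w1 f2 z2 w2 f3 z3 w3
      where x: "x = (f1, z1, w1)" and y: "y = (f2, z2, w2)" and u: "u = (f3, z3, w3)"
      by (cases x, cases y, cases u) auto
    obtain a b where n: "x \<in> normalized_belyi"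
      and a: "a \<noteq> 0" "f1 = pcompose f2 [:b, a:]" "a * z1 + b = z2" "a * w1 + b = w2"
      using xy by (auto simp: belyi_iso_def x y)
    obtain c d where n': "u \<in> normalized_belyi"
      and c: "c \<noteq> 0" "f2 = pcompose f3 [:d, c:]" "c * z2 + d = z3" "c * w2 + d = w3"
      using yu by (auto simp: belyi_iso_def u y)
    have "f1 = pcompose f3 (pcompose [:d, c:] [:b, a:])"
      by (simp add: a(2) c(2) pcompose_assoc)
    also have "pcompose [:d, c:] [:b, a:] = [:c * b + d, c * a:]"
      by (simp add: pcompose_pCons algebra_simps)
    finally have "f1 = pcompose f3 [:c * b + d, c * a:]" .
    moreover have "c * a * z1 + (c * b + d) = z3" "c * a * w1 + (c * b + d) = w3"
      using a(3,4) c(3,4) by (auto simp: algebra_simps)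
    ultimately have "\<exists>a b. a \<noteq> 0 \<and> f1 = pcompose f3 [:b, a:] \<and> a * z1 + b = z3 \<and> a * w1 + b = w3"
      using a(1) c(1) by (intro exI[of _ "c * a"] exI[of _ "c * b + d"]) simp
    then show "(x, u) \<in> belyi_iso" using n n' by (simp add: belyi_iso_def x u)
  qed
qed

lemma (in galois_element) galois_act_normalized_belyi:
  assumes "x \<in> normalized_belyi"
  shows "galois_act \<sigma> x \<in> normalized_belyi"
proof -
  obtain f z w where x: "x = (f, z, w)" by (cases x)
  have Q: "z \<in> Qbar" "w \<in> Qbar" using assms normalized_belyi_Qbar unfolding x by blast+
  have f: "belyi_polynomial f" and v: "z \<noteq> w" "poly f z \<in> {0, 1}" "poly f w \<in> {0, 1}"
    using assms by (auto simp: normalized_belyi_def x)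
  then show ?thesis
    using belyi_polynomial_map[OF f] belyi_polynomial_Qbar_polys[OF f] Q
    by (auto simp: normalized_belyi_def galois_act_def x poly_map eq_iff)
qed

lemma (in galois_element) galois_act_belyi_iso:
  assumes "(x, y) \<in> belyi_iso"
  shows "(galois_act \<sigma> x, galois_act \<sigma> y) \<in> belyi_iso"
proof -
  obtain f1 z1 w1 f2 z2 w2 where x: "x = (f1, z1, w1)" and y: "y = (f2, z2, w2)"
    by (cases x, cases y) auto
  obtain a b where n: "x \<in> normalized_belyi" "y \<in> normalized_belyi"
    and a: "a \<noteq> 0" "f1 = pcompose f2 [:b, a:]" "a * z1 + b = z2" "a * w1 + b = w2"
    using assms by (auto simp: belyi_iso_def x y)
  have Q: "z1 \<in> Qbar" "w1 \<in> Qbar" "z2 \<in> Qbar" "w2 \<in> Qbar"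
    using n normalized_belyi_Qbar unfolding x y by blast+
  have "z1 \<noteq> w1" using n by (simp add: normalized_belyi_def x)
  \<comment> \<open>The two distinct marked points determine the affine map, so its coefficients are
    algebraic and \<sigma> can be applied to them.\<close>
  then have "a = (z2 - w2) / (z1 - w1)" using a by (auto simp: field_simps)
  then have aQ: "a \<in> Qbar" using Q by (simp add: Qbar_divide Qbar_diff)
  have "b = z2 - a * z1" using a by (simp add: algebra_simps)
  then have bQ: "b \<in> Qbar" using Q aQ by (simp add: Qbar_mult Qbar_diff)
  have "f2 \<in> Qbar_polys" using n by (auto simp: normalized_belyi_def y belyi_polynomial_Qbar_polys)
  then have "map_poly \<sigma> f1 = pcompose (map_poly \<sigma> f2) [:\<sigma> b, \<sigma> a:]"
    using aQ bQ by (simp add: a(2) map_pcompose)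
  moreover have "\<sigma> a * \<sigma> z1 + \<sigma> b = \<sigma> z2" "\<sigma> a * \<sigma> w1 + \<sigma> b = \<sigma> w2"
    using a(3,4) aQ bQ Q by (auto simp: add mult Qbar_mult)
  moreover have "\<sigma> a \<noteq> 0" using a(1) aQ by (simp add: eq_0_iff)
  ultimately show ?thesis
    using galois_act_normalized_belyi[OF n(1)] galois_act_normalized_belyi[OF n(2)]
    by (auto simp: belyi_iso_def galois_act_def x y)
qed

text \<open>Well-definedness: equivalent representatives have equivalent images, so the union in
  \<open>belyi_action\<close> collapses to one class.\<close>

lemma (in galois_element) belyi_action_class:
  assumes x: "x \<in> normalized_belyi"
  shows "belyi_action \<sigma> (belyi_iso `` {x}) = belyi_iso `` {galois_act \<sigma> x}"
proof -
  have "belyi_iso `` {galois_act \<sigma> y} = belyi_iso `` {galois_act \<sigma> x}" if "y \<in> belyi_iso `` {x}" for y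
    using that galois_act_belyi_iso[of x y] equiv_class_eq[OF equiv_belyi_iso] by blast
  moreover have "x \<in> belyi_iso `` {x}" using x by (rule equiv_class_self[OF equiv_belyi_iso])
  moreover have "belyi_action \<sigma> C = (\<Union>y\<in>C. belyi_iso `` {galois_act \<sigma> y})" for C
    by (simp add: belyi_action_def galois_act_def case_prod_unfold)
  ultimately show ?thesis by blast
qed

lemma galois_act_one:
  assumes "x \<in> normalized_belyi"
  shows "galois_act \<one>\<^bsub>galois_group\<^esub> x = x"
proof -
  obtain f z w where x: "x = (f, z, w)" by (cases x)
  have "f \<in> Qbar_polys" using assms
    by (auto simp: x normalized_belyi_def belyi_polynomial_Qbar_polys)
  then have "map_poly (\<lambda>x\<in>Qbar. x) f = f"
    by (intro poly_eqI) (simp add: coeff_map_poly Qbar_polys_def)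
  then show ?thesis
    using normalized_belyi_Qbar[of f z w] assms by (simp add: galois_act_def galois_group_simps(2) x)
qed

lemma galois_act_mult:
  assumes "\<sigma> \<in> carrier galois_group" "\<tau> \<in> carrier galois_group" "x \<in> normalized_belyi"
  shows "galois_act (\<sigma> \<otimes>\<^bsub>galois_group\<^esub> \<tau>) x = galois_act \<sigma> (galois_act \<tau> x)"
proof -
  interpret s: galois_element \<sigma> by unfold_locales fact
  interpret t: galois_element \<tau> by unfold_locales fact
  obtain f z w where x: "x = (f, z, w)" by (cases x)
  have "f \<in> Qbar_polys" using assms(3)
    by (auto simp: x normalized_belyi_def belyi_polynomial_Qbar_polys)
  then have "map_poly (compose Qbar \<sigma> \<tau>) f = map_poly \<sigma> (map_poly \<tau> f)"
    by (intro poly_eqI) (simp add: coeff_map_poly Qbar_polys_def compose_def)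
  then show ?thesis
    using normalized_belyi_Qbar[of f z w] assms
    by (simp add: galois_act_def galois_group_mult x compose_def)
qed

lemma belyi_action_closed:
  assumes "\<sigma> \<in> carrier galois_group" "C \<in> belyi_classes"
  shows "belyi_action \<sigma> C \<in> belyi_classes"
proof -
  interpret galois_element \<sigma> by unfold_locales fact
  obtain x where "x \<in> normalized_belyi" "C = belyi_iso `` {x}"
    using assms(2) by (auto simp: belyi_classes_def elim: quotientE)
  then show ?thesis
    by (auto simp: belyi_action_class belyi_classes_def intro!: quotientI galois_act_normalized_belyi)
qed

lemma belyi_action_one:
  assumes "C \<in> belyi_classes"
  shows "belyi_action \<one>\<^bsub>galois_group\<^esub> C = C"
proof -
  interpret group galois_group by (rule group_galois_group)
  interpret galois_element "\<one>\<^bsub>galois_group\<^esub>" by unfold_locales simp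
  obtain x where "x \<in> normalized_belyi" "C = belyi_iso `` {x}"
    using assms by (auto simp: belyi_classes_def elim: quotientE)
  then show ?thesis by (simp add: belyi_action_class galois_act_one)
qed

lemma belyi_action_mult:
  assumes \<sigma>: "\<sigma> \<in> carrier galois_group" and \<tau>: "\<tau> \<in> carrier galois_group"
    and C: "C \<in> belyi_classes"
  shows "belyi_action (\<sigma> \<otimes>\<^bsub>galois_group\<^esub> \<tau>) C = belyi_action \<sigma> (belyi_action \<tau> C)"
proof -
  interpret group galois_group by (rule group_galois_group)
  interpret s: galois_element \<sigma> by unfold_locales fact
  interpret t: galois_element \<tau> by unfold_locales fact
  interpret st: galois_element "\<sigma> \<otimes>\<^bsub>galois_group\<^esub> \<tau>"
    by unfold_locales (use \<sigma> \<tau> in simp)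
  obtain x where x: "x \<in> normalized_belyi" "C = belyi_iso `` {x}"
    using C by (auto simp: belyi_classes_def elim: quotientE)
  then show ?thesis
    by (simp add: s.belyi_action_class t.belyi_action_class st.belyi_action_class
        t.galois_act_normalized_belyi galois_act_mult[OF \<sigma> \<tau>])
qed

section \<open>Simple zeros as the algebraic form of extra-cleanness\<close>

definition simple_zeros :: "pointed_poly \<Rightarrow> bool" where
  "simple_zeros = (\<lambda>(f, z, w). poly f z = 0 \<and> poly f w = 0 \<and>
     poly (pderiv f) z \<noteq> 0 \<and> poly (pderiv f) w \<noteq> 0)"

lemma simple_zeros_belyi_iso:
  assumes "(x, y) \<in> belyi_iso"
  shows "simple_zeros x \<longleftrightarrow> simple_zeros y"
proof -
  obtain f1 z1 w1 f2 z2 w2 where x: "x = (f1, z1, w1)" and y: "y = (f2, z2, w2)"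
    by (cases x, cases y) auto
  obtain a b where a: "a \<noteq> 0" "f1 = pcompose f2 [:b, a:]" "z2 = b + z1 * a" "w2 = b + w1 * a"
    using assms by (auto simp: belyi_iso_def x y algebra_simps)
  show ?thesis
    using a(1) unfolding x y simple_zeros_def a(2-4)
    by (simp add: poly_pcompose pderiv_pcompose pderiv_pCons)
qed

lemma (in galois_element) simple_zeros_galois_act:
  assumes "x \<in> normalized_belyi"
  shows "simple_zeros (galois_act \<sigma> x) \<longleftrightarrow> simple_zeros x"
proof -
  obtain f z w where x: "x = (f, z, w)" by (cases x)
  have "f \<in> Qbar_polys" using assms
    by (auto simp: x normalized_belyi_def belyi_polynomial_Qbar_polys)
  moreover from this have "pderiv f \<in> Qbar_polys" by (rule Qbar_polys_pderiv)
  ultimately show ?thesis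
    using assms normalized_belyi_Qbar[of f z w]
    by (simp add: simple_zeros_def galois_act_def x poly_map map_pderiv[symmetric] eq_0_iff poly_in_Qbar)
qed

definition simple_classes :: "pointed_poly set set" where
  "simple_classes = (\<lambda>x. belyi_iso `` {x}) ` {x \<in> normalized_belyi. simple_zeros x}"

lemma simple_classes_subset: "simple_classes \<subseteq> belyi_classes"
  by (auto simp: simple_classes_def belyi_classes_def intro: quotientI)

text \<open>Testing on an arbitrary representative matters because the passage to dessins supplies a
  representative of its own.\<close>

lemma simple_classes_iff:
  assumes "C \<in> belyi_classes" "x \<in> C"
  shows "C \<in> simple_classes \<longleftrightarrow> simple_zeros x"
proof -
  obtain y where y: "y \<in> normalized_belyi" "C = belyi_iso `` {y}"
    using assms(1) by (auto simp: belyi_classes_def elim: quotientE)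
  then have "(y, x) \<in> belyi_iso" using assms(2) by simp
  then have x: "x \<in> normalized_belyi" "C = belyi_iso `` {x}"
    using y equiv_class_eq[OF equiv_belyi_iso] by (auto simp: belyi_iso_def)
  show ?thesis
  proof
    assume "C \<in> simple_classes"
    then obtain u where u: "u \<in> normalized_belyi" "simple_zeros u" "C = belyi_iso `` {u}"
      by (auto simp: simple_classes_def)
    then have "(u, x) \<in> belyi_iso" using assms(2) by simp
    then show "simple_zeros x" using u(2) simple_zeros_belyi_iso by blast
  next
    assume "simple_zeros x"
    then show "C \<in> simple_classes"
      using x unfolding simple_classes_def by (intro image_eqI[of _ _ x]) simp_all
  qed
qed

lemma belyi_action_simple_classes:
  assumes "\<sigma> \<in> carrier galois_group" "C \<in> simple_classes"
  shows "belyi_action \<sigma> C \<in> simple_classes"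
proof -
  interpret galois_element \<sigma> by unfold_locales fact
  obtain x where "x \<in> normalized_belyi" "simple_zeros x" "C = belyi_iso `` {x}"
    using assms(2) by (auto simp: simple_classes_def)
  then show ?thesis
    unfolding simple_classes_def
    by (intro image_eqI[of _ _ "galois_act \<sigma> x"])
      (simp_all add: belyi_action_class galois_act_normalized_belyi simple_zeros_galois_act)
qed

lemma belyi_action_moves_simple_class:
  assumes \<sigma>: "\<sigma> \<in> carrier galois_group" and ne: "\<sigma> \<noteq> \<one>\<^bsub>galois_group\<^esub>"
  shows "\<exists>C\<in>simple_classes. belyi_action \<sigma> C \<noteq> C"
proof -
  interpret galois_element \<sigma> by unfold_locales fact
  have "\<sigma> \<in> extensional Qbar" using \<sigma> by (simp add: galois_group_simps Bij_def)
  then have "\<exists>\<alpha>\<in>Qbar. \<sigma> \<alpha> \<noteq> \<alpha>"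
    using ne unfolding galois_group_simps(2)
    by (metis extensionalityI restrict_apply' restrict_extensional)
  then obtain \<alpha> where \<alpha>: "\<alpha> \<in> Qbar" "\<sigma> \<alpha> \<noteq> \<alpha>" by blast
  \<comment> \<open>\<sigma> fixes 0 and 1, so \<alpha> is neither of them, and by injectivity nor
    is its image.\<close>
  have \<alpha>01: "\<alpha> \<notin> {0, 1}" using \<alpha>(2) by auto
  then have \<sigma>\<alpha>01: "\<sigma> \<alpha> \<notin> {0, 1}" using eq_iff[OF \<alpha>(1), of 0] eq_iff[OF \<alpha>(1), of 1] by auto
  obtain Q where Q: "degree Q > 0" "belyi_polynomial (pcompose (of_rat_poly Q) (lenstra_poly \<alpha>))"
    using belyi_polynomial_from_algebraic[OF lenstra_poly_in_Qbar_polys[OF \<alpha>(1)]] by auto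
  define f where "f = pcompose (of_rat_poly Q) (lenstra_poly \<alpha>)"
  obtain z w where zw: "z \<noteq> w" "poly f z = 0" "poly f w = 0"
    "poly (pderiv f) z \<noteq> 0" "poly (pderiv f) w \<noteq> 0"
    using belyi_two_simple_zeros[OF Q(2)] unfolding f_def by blast
  let ?x = "(f, z, w)"
  have x: "?x \<in> normalized_belyi" "simple_zeros ?x"
    using zw Q(2) by (simp_all add: normalized_belyi_def simple_zeros_def f_def)
  \<comment> \<open>\<open>Q\<close> has rational coefficients, so \<sigma> changes only the
    parameter \<alpha>.\<close>
  have \<sigma>f: "map_poly \<sigma> f = pcompose (of_rat_poly Q) (lenstra_poly (\<sigma> \<alpha>))"
    using \<alpha>(1) by (simp add: f_def map_pcompose lenstra_poly_in_Qbar_polys map_lenstra_poly)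
  have "belyi_action \<sigma> (belyi_iso `` {?x}) \<noteq> belyi_iso `` {?x}"
  proof
    assume "belyi_action \<sigma> (belyi_iso `` {?x}) = belyi_iso `` {?x}"
    then have "belyi_iso `` {?x} = belyi_iso `` {galois_act \<sigma> ?x}"
      by (simp only: belyi_action_class[OF x(1)])
    then have "(?x, galois_act \<sigma> ?x) \<in> belyi_iso"
      using eq_equiv_class[OF _ equiv_belyi_iso galois_act_normalized_belyi[OF x(1)]] by blast
    then obtain a b where "a \<noteq> 0" and fab: "f = pcompose (map_poly \<sigma> f) [:b, a:]"
      by (auto simp: belyi_iso_def galois_act_def)
    have "\<alpha> = \<sigma> \<alpha>"
      using lenstra_poly_affine_invariant[OF \<alpha>01 \<sigma>\<alpha>01 _ \<open>a \<noteq> 0\<close>, of "of_rat_poly Q" b] Q(1)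
        fab[unfolded \<sigma>f, unfolded f_def] by simp
    then show False using \<alpha>(2) by simp
  qed
  moreover have "belyi_iso `` {?x} \<in> simple_classes"
    unfolding simple_classes_def by (rule imageI) (use x in simp)
  ultimately show ?thesis by blast
qed

section \<open>Transfer to dessins\<close>

lemma extra_clean_dessin_iso:
  assumes "(x, y) \<in> dessin_iso" "x \<in> extra_clean_dessins"
  shows "y \<in> extra_clean_dessins"
proof -
  obtain D1 z1 w1 D2 z2 w2 where x: "x = (D1, z1, w1)" and y: "y = (D2, z2, w2)"
    by (cases x, cases y) auto
  obtain h where n: "y \<in> normalized_dessins" and h: "orientation_preserving_homeo h"
      "(\<lambda>e. h ` e) ` edges D1 = edges D2" "h z1 = z2" "h w1 = w2"
    using assms(1) by (auto simp: dessin_iso_def x y)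
  obtain k where "homeomorphism UNIV UNIV h k"
    using h(1) by (auto simp: orientation_preserving_homeo_def)
  then have "inj h" by (metis homeomorphism_apply1 injI UNIV_I)
  have "edges_at D2 (h v) = (\<lambda>e. h ` e) ` edges_at D1 v" for v
    by (auto simp: edges_at_def inj_eq[OF \<open>inj h\<close>] simp flip: h(2))
  moreover have "inj_on (\<lambda>e. h ` e) (edges_at D1 v)" for v
    using \<open>inj h\<close> by (auto simp: inj_on_def inj_image_eq_iff)
  ultimately have "card (edges_at D2 (h v)) = card (edges_at D1 v)" for v
    by (simp add: card_image)
  then show ?thesis
    using assms(2) n h(3,4) by (auto simp: extra_clean_dessins_def x y)
qed

text \<open>A white vertex meets two edges, so ends are black, and
  \<open>card_edges_at_dessin_of\<close> recognises them.\<close>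

lemma extra_clean_dessin_of_iff:
  assumes "(f, z, w) \<in> normalized_belyi" and n: "(dessin_of f, z, w) \<in> normalized_dessins"
  shows "(dessin_of f, z, w) \<in> extra_clean_dessins \<longleftrightarrow> simple_zeros (f, z, w)"
proof -
  have D: "dessin (dessin_of f)" using n by (simp add: normalized_dessins_def)
  have deg: "degree f > 0" and v: "poly f z \<in> {0, 1}" "poly f w \<in> {0, 1}"
    using assms(1) by (auto simp: normalized_belyi_def belyi_polynomial_def)
  have "card (edges_at (dessin_of f) x) = 1 \<longleftrightarrow> poly f x = 0 \<and> poly (pderiv f) x \<noteq> 0"
    if "poly f x \<in> {0, 1}" for x
  proof (cases "poly f x = 0")
    case True
    then show ?thesis using card_edges_at_dessin_of[OF D True deg] by simp
  next
    case False
    then have "x \<in> white (dessin_of f)" using that by (simp add: dessin_of_def)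
    then show ?thesis using D False by (simp add: dessin_def)
  qed
  then show ?thesis using n v by (auto simp: extra_clean_dessins_def simple_zeros_def)
qed

text \<open>That some \<open>dessin_of f\<close> is a dessin is not shown by topology but extracted
  from the correspondence: a dessin class is nonempty, the elements of
  \<open>class_dessin_of C\<close> are related to drawings of elements of \<open>C\<close>, and
  \<open>dessin_iso\<close> relates normalized dessins only.\<close>

lemma class_dessin_of_representative:
  assumes "class_dessin_of C \<in> dessin_classes"
  obtains f z w where "(f, z, w) \<in> C" "(dessin_of f, z, w) \<in> normalized_dessins"
    "class_dessin_of C = dessin_iso `` {(dessin_of f, z, w)}"
proof -
  obtain x where x: "x \<in> normalized_dessins" "class_dessin_of C = dessin_iso `` {x}"
    using assms by (auto simp: dessin_classes_def elim: quotientE)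
  then have "x \<in> class_dessin_of C" using equiv_class_self[OF equiv_dessin_iso x(1)] by simp
  then obtain f z w where f: "(f, z, w) \<in> C" "((dessin_of f, z, w), x) \<in> dessin_iso"
    by (auto simp: class_dessin_of_def)
  from f(2) have n: "(dessin_of f, z, w) \<in> normalized_dessins"
    by (auto simp: dessin_iso_def)
  have "class_dessin_of C = dessin_iso `` {(dessin_of f, z, w)}"
    using x(2) equiv_class_eq[OF equiv_dessin_iso f(2)] by simp
  with f(1) n show ?thesis by (rule that)
qed

lemma extra_clean_class_iff:
  assumes C: "C \<in> belyi_classes" and \<Phi>: "class_dessin_of C \<in> dessin_classes"
  shows "class_dessin_of C \<in> extra_clean_classes \<longleftrightarrow> C \<in> simple_classes"
proof -
  obtain f z w where f: "(f, z, w) \<in> C" "(dessin_of f, z, w) \<in> normalized_dessins"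
    "class_dessin_of C = dessin_iso `` {(dessin_of f, z, w)}"
    using class_dessin_of_representative[OF \<Phi>] .
  let ?y = "(dessin_of f, z, w)"
  have "(f, z, w) \<in> normalized_belyi"
    using C f(1) by (auto simp: belyi_classes_def belyi_iso_def elim!: quotientE)
  then have "C \<in> simple_classes \<longleftrightarrow> ?y \<in> extra_clean_dessins"
    using simple_classes_iff[OF C f(1)] extra_clean_dessin_of_iff f(2) by blast
  also have "\<dots> \<longleftrightarrow> class_dessin_of C \<in> extra_clean_classes"
  proof
    assume "?y \<in> extra_clean_dessins"
    then show "class_dessin_of C \<in> extra_clean_classes"
      unfolding f(3) extra_clean_classes_def by (rule quotientI)
  next
    assume "class_dessin_of C \<in> extra_clean_classes"
    then obtain u where u: "u \<in> extra_clean_dessins" "dessin_iso `` {?y} = dessin_iso `` {u}"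
      by (auto simp: extra_clean_classes_def f(3) elim: quotientE)
    then have "(u, ?y) \<in> dessin_iso"
      using eq_equiv_class[OF _ equiv_dessin_iso f(2)] by metis
    then show "?y \<in> extra_clean_dessins" using u(1) by (rule extra_clean_dessin_iso)
  qed
  finally show ?thesis by blast
qed

theorem theorem3p7:
  assumes grothendieck_correspondence: "bij_betw class_dessin_of belyi_classes dessin_classes"
  shows "faithful_action galois_group extra_clean_classes
           (\<lambda>\<sigma>. restrict (dessin_action \<sigma>) extra_clean_classes) \<and>
         faithful_action galois_group dessin_classes
           (\<lambda>\<sigma>. restrict (dessin_action \<sigma>) dessin_classes)"
proof -
  have act: "dessin_action \<sigma> (class_dessin_of C) = class_dessin_of (belyi_action \<sigma> C)"
    if "C \<in> belyi_classes" for \<sigma> C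
    using bij_betw_inv_into_left[OF grothendieck_correspondence that] by (simp add: dessin_action_def)
  \<comment> \<open>Both claims are instances, with \<open>\<C>\<close> the simple classes or all
    classes; the moved class is simple, so it lies in either.\<close>
  have faithful: "faithful_action galois_group X (\<lambda>\<sigma>. restrict (dessin_action \<sigma>) X)"
    if X: "X = class_dessin_of ` \<C>" "simple_classes \<subseteq> \<C>" "\<C> \<subseteq> belyi_classes"
      and closed: "\<And>\<sigma> C. \<sigma> \<in> carrier galois_group \<Longrightarrow> C \<in> \<C> \<Longrightarrow> belyi_action \<sigma> C \<in> \<C>" for X \<C>
  proof (rule faithful_actionI[OF group_galois_group])
    show "dessin_action \<sigma> x \<in> X" if "\<sigma> \<in> carrier galois_group" "x \<in> X" for \<sigma> x
      using that X(1,3) closed by (auto simp: act subset_iff)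
    show "dessin_action \<one>\<^bsub>galois_group\<^esub> x = x" if "x \<in> X" for x
      using that X(1,3) by (auto simp: act belyi_action_one subset_iff)
    show "dessin_action (\<sigma> \<otimes>\<^bsub>galois_group\<^esub> \<tau>) x = dessin_action \<sigma> (dessin_action \<tau> x)"
      if "\<sigma> \<in> carrier galois_group" "\<tau> \<in> carrier galois_group" "x \<in> X" for \<sigma> \<tau> x
      using that X(1,3) by (auto simp: act belyi_action_mult belyi_action_closed subset_iff)
    show "\<exists>x\<in>X. dessin_action \<sigma> x \<noteq> x"
      if \<sigma>: "\<sigma> \<in> carrier galois_group" "\<sigma> \<noteq> \<one>\<^bsub>galois_group\<^esub>" for \<sigma>
    proof -
      obtain C where C: "C \<in> simple_classes" "belyi_action \<sigma> C \<noteq> C"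
        using belyi_action_moves_simple_class[OF \<sigma>] by blast
      then have C': "C \<in> belyi_classes" "C \<in> \<C>" using X(2,3) by auto
      then have "class_dessin_of (belyi_action \<sigma> C) \<noteq> class_dessin_of C"
        using C(2) belyi_action_closed[OF \<sigma>(1) C'(1)]
        by (simp add: inj_on_eq_iff[OF bij_betw_imp_inj_on[OF grothendieck_correspondence]])
      then show ?thesis using C' X(1) act[OF C'(1), of \<sigma>] by auto
    qed
  qed
  have all: "dessin_classes = class_dessin_of ` belyi_classes"
    using grothendieck_correspondence by (simp add: bij_betw_def)
  have sub: "extra_clean_classes \<subseteq> dessin_classes"
    by (auto simp: extra_clean_classes_def dessin_classes_def extra_clean_dessins_def
        elim!: quotientE intro!: quotientI)
  have iff: "class_dessin_of C \<in> extra_clean_classes \<longleftrightarrow> C \<in> simple_classes"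
    if "C \<in> belyi_classes" for C
    by (rule extra_clean_class_iff[OF that]) (simp add: all imageI[OF that])
  have extra: "extra_clean_classes = class_dessin_of ` simple_classes"
  proof (intro equalityI subsetI)
    fix c assume c: "c \<in> extra_clean_classes"
    then have "c \<in> class_dessin_of ` belyi_classes" unfolding all[symmetric] by (rule subsetD[OF sub])
    then obtain C where "C \<in> belyi_classes" "c = class_dessin_of C" by (elim imageE)
    with c iff show "c \<in> class_dessin_of ` simple_classes" by simp
  qed (use iff simple_classes_subset in auto)
  show ?thesis
    by (rule conjI[OF faithful[OF extra order_refl simple_classes_subset belyi_action_simple_classes]
          faithful[OF all simple_classes_subset order_refl belyi_action_closed]])
qed

end
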